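(* There exists an FIID labeling $\Theta\in[0,1]^{V(\mathbb{T}_3)}$ of the $3$-regular tree $\mathbb{T}_3$ whose marginals are uniform on $[0,1]$ and for which, almost surely, every cluster of $\mathsf{clust}(\Theta)$ is infinite.
   Context: $\mathbb{T}_3$ is the infinite $3$-regular tree, regarded as a (right) Cayley graph of a countable group $\Gamma$ (for example $\Gamma=\mathbb{Z}/2*\mathbb{Z}/2*\mathbb{Z}/2$ with its three standard generators), so $V(\mathbb{T}_3)=\Gamma$ and $\Gamma$ acts on $\mathbb{T}_3$ by left multiplication. FIID (factor of i.i.d.): for a measurable label space $S$, $\Gamma$ acts on $S^\Gamma$ by $(\gamma\cdot L)(\delta)=L(\gamma^{-1}\delta)$. An FIID labeling is a random element $\Theta=f(\omega)$ of $S^\Gamma$, where $\omega=\{\omega_\gamma\}_{\gamma\in\Gamma}$ is an i.i.d. family of uniform $[0,1]$ random variables and $f:[0,1]^\Gamma\to S^\Gamma$ is a measurable $\Gamma$-equivariant map. The marginal of $\Theta$ is the distribution of $\Theta(\gamma)$, which does not depend on $\gamma\in\Gamma$. For a labeling $\mathcal{L}$ of the vertices of a graph, $\mathsf{clust}(\mathcal{L})$ is the (spanning) subgraph obtained by deleting every edge whose endpoints have different $\mathcal{L}$-labels; its connected components are called clusters. *)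

theory Defs
  imports "HOL-Probability.Probability" "HOL-Algebra.Group"
begin

text \<open>A simple undirected graph is given by its vertex set \<open>V\<close> and its symmetric, irreflexive
  adjacency relation \<open>E\<close>; an undirected edge is thus represented by two ordered pairs, which is why
  cycles are required to have at least three vertices.\<close>

definition simple_graph :: "'a set \<Rightarrow> 'a rel \<Rightarrow> bool" where
  "simple_graph V E \<longleftrightarrow> E \<subseteq> V \<times> V \<and> sym E \<and> irrefl E"

definition graph_cycle :: "'a rel \<Rightarrow> 'a list \<Rightarrow> bool" where
  "graph_cycle E xs \<longleftrightarrow> 3 \<le> length xs \<and> distinct xs \<and>
     successively (\<lambda>x y. (x, y) \<in> E) xs \<and> (last xs, hd xs) \<in> E"

definition graph_component :: "'a rel \<Rightarrow> 'a \<Rightarrow> 'a set" where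
  "graph_component E x = {y. (x, y) \<in> E\<^sup>*}"

definition graph_components :: "'a set \<Rightarrow> 'a rel \<Rightarrow> 'a set set" where
  "graph_components V E = graph_component E ` V"

definition is_tree :: "'a set \<Rightarrow> 'a rel \<Rightarrow> bool" where
  "is_tree V E \<longleftrightarrow> simple_graph V E \<and> V \<noteq> {} \<and> (\<forall>x\<in>V. \<forall>y\<in>V. (x, y) \<in> E\<^sup>*) \<and>
     (\<nexists>xs. graph_cycle E xs)"

definition regular_tree :: "nat \<Rightarrow> 'a set \<Rightarrow> 'a rel \<Rightarrow> bool" where
  "regular_tree d V E \<longleftrightarrow> is_tree V E \<and> (\<forall>x\<in>V. finite {y. (x, y) \<in> E} \<and> card {y. (x, y) \<in> E} = d)"

definition cayley_edges :: "('a, 'm) monoid_scheme \<Rightarrow> 'a set \<Rightarrow> 'a rel" where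
  "cayley_edges G S = {(x, x \<otimes>\<^bsub>G\<^esub> s) | x s. x \<in> carrier G \<and> s \<in> S}"

text \<open>The adjacency relation of the spanning subgraph \<open>clust(L)\<close>.\<close>

definition clust :: "'a rel \<Rightarrow> ('a \<Rightarrow> 's) \<Rightarrow> 'a rel" where
  "clust E L = {(x, y) \<in> E. L x = L y}"

definition clusters :: "'a set \<Rightarrow> 'a rel \<Rightarrow> ('a \<Rightarrow> 's) \<Rightarrow> 'a set set" where
  "clusters V E L = graph_components V (clust E L)"

text \<open>The space \<open>[0,1]\<close> with its Borel sets and the uniform distribution.\<close>

definition unit_interval :: "real measure" where
  "unit_interval = restrict_space lborel {0..1}"

text \<open>The law, on \<open>[0,1]\<^sup>G\<close>, of an i.i.d. family of uniform random variables.\<close>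

definition iid_uniform :: "('a, 'm) monoid_scheme \<Rightarrow> ('a \<Rightarrow> real) measure" where
  "iid_uniform G = (\<Pi>\<^sub>M \<gamma>\<in>carrier G. unit_interval)"

definition shift :: "('a, 'm) monoid_scheme \<Rightarrow> 'a \<Rightarrow> ('a \<Rightarrow> 's) \<Rightarrow> 'a \<Rightarrow> 's" where
  "shift G \<gamma> L = (\<lambda>\<delta>\<in>carrier G. L (inv\<^bsub>G\<^esub> \<gamma> \<otimes>\<^bsub>G\<^esub> \<delta>))"

text \<open>FIID labelings with values in the measurable space \<open>N\<close> (only its sigma-algebra matters).
  The random labeling is a random variable on the canonical space \<open>iid_uniform G\<close>.\<close>

definition fiid_labeling ::
  "('a, 'm) monoid_scheme \<Rightarrow> 's measure \<Rightarrow> (('a \<Rightarrow> real) \<Rightarrow> 'a \<Rightarrow> 's) \<Rightarrow> bool" where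
  "fiid_labeling G N \<Theta> \<longleftrightarrow>
     \<Theta> \<in> iid_uniform G \<rightarrow>\<^sub>M (\<Pi>\<^sub>M \<gamma>\<in>carrier G. N) \<and>
     (\<forall>\<gamma>\<in>carrier G. \<forall>\<omega>\<in>space (iid_uniform G). \<Theta> (shift G \<gamma> \<omega>) = shift G \<gamma> (\<Theta> \<omega>))"

definition marginal ::
  "('a, 'm) monoid_scheme \<Rightarrow> 's measure \<Rightarrow> (('a \<Rightarrow> real) \<Rightarrow> 'a \<Rightarrow> 's) \<Rightarrow> 'a \<Rightarrow> 's measure" where
  "marginal G N \<Theta> \<gamma> = distr (iid_uniform G) N (\<lambda>\<omega>. \<Theta> \<omega> \<gamma>)"

end

theory Submission
  imports Defs
begin

text \<open>Labels are sequences of fair bits. Each round, every cluster tosses a coin (head or tail), and with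
  small probability its label is replaced by a fresh one; then every tail cluster joins an adjacent head
  cluster and takes over its label, preferring one whose label agrees with its own on a prescribed number
  of leading bits. A finite connected set of \<open>n\<close> vertices has \<open>n + 2\<close> neighbours in \<open>\<T>\<^sub>3\<close>,
  lying in distinct clusters, so a large cluster sees many adjacent clusters with fresh labels, and fails to
  find a head with a close label only with small probability. Since by mass transport the cluster sizes
  grow exponentially, Borel-Cantelli shows that each bit of each label changes only finitely often.
  The limit labels are constant on the infinite unions of clusters, and flipping the same bits in all fresh
  labels flips these bits in the limit, which forces its law to be uniform.\<close>

section \<open>Trees\<close>

text \<open>The label that a cluster has to match depends on the whole past, and so do the labels of
  its neighbours, so no independence between them can be used. Fresh labels restore it. With
  \<open>p = precision m\<close>, each adjacent cluster, given the past and independently of the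
  others, is a head, is flagged and draws a label with \<open>p\<close> prescribed leading bits with
  probability 2 to the power -(2p + 1), whatever these bits are. The price is that a label is
  replaced with probability 2 to the power -p. The number of neighbours has to beat 4 to the power
  p, hence the interest in growth: a root survives a round with probability at most 3/4, and a
  cluster smaller than (5/4)^m then has probability at most (15/16)^m. The law of a label after many
  choices is never computed. Since the rules only compare labels with each other, they commute with
  flipping a fixed set of bits in all labels, and the fair coin law is the only law on bit sequences
  that is invariant under all such flips.\<close>

lemma rtrancl_imp_distinct_path:
  assumes "(x, y) \<in> R\<^sup>*" "R \<subseteq> A \<times> A" "y \<in> A"
  shows "\<exists>xs. xs \<noteq> [] \<and> hd xs = x \<and> last xs = y \<and> distinct xs \<and>
    successively (\<lambda>x y. (x, y) \<in> R) xs \<and> set xs \<subseteq> A"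
  using assms(1)
proof (induction rule: converse_rtrancl_induct)
  case base
  then show ?case using assms(3) by (intro exI[of _ "[y]"]) auto
next
  case (step x z)
  then obtain xs where xs: "xs \<noteq> []" "hd xs = z" "last xs = y" "distinct xs"
    "successively (\<lambda>x y. (x, y) \<in> R) xs" "set xs \<subseteq> A" by auto
  show ?case
  proof (cases "x \<in> set xs")
    case True
    then obtain us vs where "xs = us @ x # vs" by (meson split_list)
    then show ?thesis using xs
      by (intro exI[of _ "x # vs"]) (auto simp: successively_append_iff)
  next
    case False
    then show ?thesis using xs step(1) assms(2)
      by (intro exI[of _ "x # xs"]) (cases xs; auto)
  qed
qed

lemma sym_Int_Times: "sym E \<Longrightarrow> sym (E \<inter> A \<times> A)"
  by (auto simp: sym_def)

text \<open>Simple paths inside \<open>A\<close> and inside \<open>B\<close>, joined by the two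
  crossing edges, close up without repeating a vertex. At least three vertices are involved unless
  both paths are single points, that is, unless the two edges coincide; so distinct crossing edges
  would give a cycle.\<close>

lemma acyclic_unique_crossing_edge:
  assumes "sym E" and acyc: "\<nexists>xs. graph_cycle E xs" and "A \<inter> B = {}"
    and A: "a1 \<in> A" "a2 \<in> A" "(a1, a2) \<in> (E \<inter> A \<times> A)\<^sup>*"
    and B: "b1 \<in> B" "b2 \<in> B" "(b1, b2) \<in> (E \<inter> B \<times> B)\<^sup>*"
    and e: "(a1, b1) \<in> E" "(a2, b2) \<in> E"
  shows "a1 = a2" "b1 = b2"
proof -
  have "(b2, b1) \<in> (E \<inter> B \<times> B)\<^sup>*"
    using B(3) sym_Int_Times[OF assms(1)] by (metis sym_rtrancl symD)
  then obtain ys where ys: "ys \<noteq> []" "hd ys = b2" "last ys = b1" "distinct ys"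
    "successively (\<lambda>x y. (x, y) \<in> E \<inter> B \<times> B) ys" "set ys \<subseteq> B"
    using rtrancl_imp_distinct_path[of b2 b1 "E \<inter> B \<times> B" B] B by auto
  obtain xs where xs: "xs \<noteq> []" "hd xs = a1" "last xs = a2" "distinct xs"
    "successively (\<lambda>x y. (x, y) \<in> E \<inter> A \<times> A) xs" "set xs \<subseteq> A"
    using rtrancl_imp_distinct_path[of a1 a2 "E \<inter> A \<times> A" A] A by auto
  have "a1 = a2 \<and> b1 = b2"
  proof (rule ccontr)
    assume "\<not> (a1 = a2 \<and> b1 = b2)"
    then have "3 \<le> length (xs @ ys)"
      using xs(1-3) ys(1-3) by (cases xs; cases "tl xs"; cases ys; cases "tl ys") auto
    moreover have "distinct (xs @ ys)" using xs ys assms(3) by auto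
    moreover have "successively (\<lambda>x y. (x, y) \<in> E) (xs @ ys)"
      using xs ys e by (auto simp: successively_append_iff elim!: successively_mono)
    moreover have "(last (xs @ ys), hd (xs @ ys)) \<in> E"
      using xs ys e assms(1) by (auto dest: symD)
    ultimately show False using acyc unfolding graph_cycle_def by blast
  qed
  then show "a1 = a2" "b1 = b2" by auto
qed

definition connected_in :: "'a rel \<Rightarrow> 'a set \<Rightarrow> bool" where
  "connected_in E C \<longleftrightarrow> (\<forall>x\<in>C. \<forall>y\<in>C. (x, y) \<in> (E \<inter> C \<times> C)\<^sup>*)"

definition outer_boundary :: "'a rel \<Rightarrow> 'a set \<Rightarrow> 'a set" where
  "outer_boundary E C = {y. y \<notin> C \<and> (\<exists>x\<in>C. (x, y) \<in> E)}"

lemma rtrancl_exit: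
  assumes "(x, y) \<in> R\<^sup>*" "x \<in> C" "y \<notin> C"
  shows "\<exists>u v. (u, v) \<in> R \<and> u \<in> C \<and> v \<notin> C"
  using assms by (induction rule: rtrancl_induct) auto

lemma connected_in_insert:
  assumes "sym E" "connected_in E C" "x \<in> C" "(x, y) \<in> E"
  shows "connected_in E (insert y C)"
proof -
  let ?R = "E \<inter> insert y C \<times> insert y C"
  have mono: "(E \<inter> C \<times> C)\<^sup>* \<subseteq> ?R\<^sup>*" by (intro rtrancl_mono) auto
  have to_x: "(u, x) \<in> ?R\<^sup>*" if "u \<in> insert y C" for u
  proof (cases "u \<in> C")
    case True
    then show ?thesis using assms mono unfolding connected_in_def by blast
  next
    case False
    then have "u = y" using that by simp
    then show ?thesis using assms by (auto dest: symD)
  qed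
  have "(x, u) \<in> ?R\<^sup>*" if "u \<in> insert y C" for u
    using to_x[OF that] sym_Int_Times[OF assms(1)] by (metis sym_rtrancl symD)
  then show ?thesis unfolding connected_in_def using to_x by (meson rtrancl_trans)
qed

text \<open>A single vertex has 3 = 1 + 2 neighbours. Adding a boundary vertex \<open>y\<close>
  trades \<open>y\<close> for its two neighbours outside, so size and boundary both grow by one.
  Connected sets of every size up to \<open>card D\<close> are grown inside \<open>D\<close>; the
  one of full size is \<open>D\<close> itself.\<close>

lemma card_outer_boundary:
  assumes E: "sym E" "irrefl E" "\<nexists>xs. graph_cycle E xs"
    and reg: "\<And>x. x \<in> D \<Longrightarrow> finite {y. (x, y) \<in> E} \<and> card {y. (x, y) \<in> E} = 3"
    and D: "finite D" "D \<noteq> {}" "connected_in E D"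
  shows "finite (outer_boundary E D) \<and> card (outer_boundary E D) = card D + 2"
proof -
  have "\<exists>C\<subseteq>D. card C = Suc n \<and> connected_in E C \<and>
      finite (outer_boundary E C) \<and> card (outer_boundary E C) = Suc n + 2"
    if "Suc n \<le> card D" for n using that
  proof (induction n)
    case 0
    obtain x where x: "x \<in> D" using D by auto
    have "outer_boundary E {x} = {y. (x, y) \<in> E}"
      using E(2) by (auto simp: outer_boundary_def irrefl_def)
    then show ?case using x reg[OF x]
      by (intro exI[of _ "{x}"]) (auto simp: connected_in_def)
  next
    case (Suc n)
    then obtain C where C: "C \<subseteq> D" "card C = Suc n" "connected_in E C"
      "finite (outer_boundary E C)" "card (outer_boundary E C) = Suc n + 2" by auto
    have finC: "finite C" using C(1) D(1) finite_subset by auto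
    obtain c where c: "c \<in> C" using C(2) by fastforce
    have "C \<noteq> D" using C(2) Suc.prems by auto
    then obtain d where d: "d \<in> D" "d \<notin> C" using C(1) by auto
    have "(c, d) \<in> (E \<inter> D \<times> D)\<^sup>*" using D(3) c d C(1) unfolding connected_in_def by auto
    from rtrancl_exit[OF this c d(2)] obtain x y where
      xy: "(x, y) \<in> E" "x \<in> C" "y \<in> D" "y \<notin> C" by auto
    define N where "N = {z. (y, z) \<in> E}"
    have xN: "x \<in> N" using xy(1) E(1) by (auto simp: N_def dest: symD)
    have uniq: "z = x" if "z \<in> C" "z \<in> N" for z
      using acyclic_unique_crossing_edge(1)[of E C "{y}" z x y y] that xy E C(3)
      unfolding connected_in_def N_def by (auto dest: symD)
    \<comment> \<open>A neighbour \<open>z\<close> of \<open>y\<close> that already bounds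
      \<open>C\<close> would give two edges from \<open>C\<close> to the connected pair
      \<open>{y, z}\<close>, which a tree forbids.\<close>
    have newN: "z \<notin> outer_boundary E C" if "z \<in> N" for z
    proof
      assume "z \<in> outer_boundary E C"
      then obtain u where u: "z \<notin> C" "u \<in> C" "(u, z) \<in> E" by (auto simp: outer_boundary_def)
      have "y \<noteq> z" using that E(2) by (auto simp: N_def irrefl_def)
      moreover have "(y, z) \<in> (E \<inter> {y, z} \<times> {y, z})\<^sup>*" using that by (auto simp: N_def)
      ultimately show False
        using acyclic_unique_crossing_edge(2)[of E C "{y, z}" x u y z] u xy E C(3)
        unfolding connected_in_def by auto
    qed
    have N: "finite N" "card N = 3" using reg[OF xy(3)] by (auto simp: N_def)
    have yN: "y \<notin> N" using E(2) by (auto simp: N_def irrefl_def)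
    have eq: "outer_boundary E (insert y C) = (outer_boundary E C - {y}) \<union> (N - {x})"
    proof (rule Set.set_eqI)
      fix z
      show "z \<in> outer_boundary E (insert y C) \<longleftrightarrow> z \<in> (outer_boundary E C - {y}) \<union> (N - {x})"
        using xy(2,4) uniq[of z] yN unfolding outer_boundary_def N_def by blast
    qed
    have y: "y \<in> outer_boundary E C" using xy by (auto simp: outer_boundary_def)
    have "card (outer_boundary E (insert y C)) =
        card (outer_boundary E C - {y}) + card (N - {x})"
      unfolding eq using N C(4) newN by (intro card_Un_disjoint) auto
    also have "\<dots> = Suc (Suc n) + 2" using C(4,5) N y xN by simp
    finally have "card (outer_boundary E (insert y C)) = Suc (Suc n) + 2" .
    moreover have "finite (outer_boundary E (insert y C))" unfolding eq using C(4) N(1) by auto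
    moreover have "connected_in E (insert y C)" using connected_in_insert[OF E(1) C(3) xy(2,1)] .
    ultimately show ?case using C(1,2) xy finC by (intro exI[of _ "insert y C"]) auto
  qed
  moreover have "Suc (card D - 1) = card D" using D(1,2) by (simp add: card_gt_0_iff)
  ultimately obtain C where C: "C \<subseteq> D" "card C = card D"
      "finite (outer_boundary E C)" "card (outer_boundary E C) = card D + 2"
    by (metis order_refl)
  then have "C = D" using card_subset_eq[OF D(1)] by blast
  then show ?thesis using C by blast
qed

section \<open>Fields of fair coins\<close>

definition coin :: "bool measure" where "coin = measure_pmf (bernoulli_pmf (1 / 2))"

definition bits :: "'i set \<Rightarrow> ('i \<Rightarrow> bool) measure" where "bits I = (\<Pi>\<^sub>M i\<in>I. coin)"

lemma prob_space_coin: "prob_space coin"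
  unfolding coin_def by (rule prob_space_measure_pmf)

lemma space_coin [simp]: "space coin = UNIV" and sets_coin [simp, measurable_cong]: "sets coin = UNIV"
  by (simp_all add: coin_def)

lemma measurable_coin_iff [simp]: "M \<rightarrow>\<^sub>M coin = M \<rightarrow>\<^sub>M count_space UNIV"
  by (rule measurable_cong_sets) auto

lemma measure_coin_singleton [simp]: "measure coin {b} = 1 / 2"
  by (cases b) (auto simp: coin_def measure_pmf_single)

lemma measure_coin_UNIV [simp]: "measure coin UNIV = 1"
  using prob_space.prob_space[OF prob_space_coin] by simp

lemma prob_space_bits: "prob_space (bits I)"
  unfolding bits_def by (intro prob_space_PiM prob_space_coin)

lemma space_bits: "space (bits I) = (\<Pi>\<^sub>E i\<in>I. UNIV)"
  by (simp add: bits_def space_PiM)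

lemma measurable_bits_component [measurable]:
  "i \<in> I \<Longrightarrow> Measurable.pred (bits I) (\<lambda>\<omega>. \<omega> i)"
  unfolding bits_def using measurable_component_singleton[of i I "\<lambda>_. coin"] by simp

lemma measurable_bitsI:
  assumes "\<And>i. i \<in> I \<Longrightarrow> Measurable.pred M (\<lambda>\<omega>. f \<omega> i)"
    and "\<And>\<omega>. \<omega> \<in> space M \<Longrightarrow> f \<omega> \<in> extensional I"
  shows "f \<in> M \<rightarrow>\<^sub>M bits I"
  unfolding bits_def
proof (rule measurable_PiM_single')
  show "f \<in> space M \<rightarrow> (\<Pi>\<^sub>E i\<in>I. space coin)" using assms(2) by (auto simp: PiE_def)
qed (use assms(1) in simp)

lemma sets_bits_cylinder:
  assumes "finite J" "J \<subseteq> I"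
  shows "{\<omega> \<in> space (bits I). \<forall>i\<in>J. \<omega> i = w i} \<in> sets (bits I)"
proof -
  have "{\<omega> \<in> space (bits I). \<forall>i\<in>J. \<omega> i = w i} = prod_emb I (\<lambda>_. coin) J (\<Pi>\<^sub>E i\<in>J. {w i})"
    by (auto simp: bits_def prod_emb_def space_PiM)
  then show ?thesis using assms by (auto simp: bits_def intro!: sets_PiM_I)
qed

lemma measure_bits_cylinder:
  assumes "finite J" "J \<subseteq> I"
  shows "measure (bits I) {\<omega> \<in> space (bits I). \<forall>i\<in>J. \<omega> i = w i} = (1 / 2) ^ card J"
proof -
  interpret product_prob_space "\<lambda>_. coin" I
    by (intro product_prob_spaceI prob_space_coin)
  have "{\<omega> \<in> space (bits I). \<forall>i\<in>J. \<omega> i = w i} = emb I J (\<Pi>\<^sub>E i\<in>J. {w i})"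
    by (auto simp: bits_def prod_emb_def space_PiM)
  then show ?thesis
    using measure_PiM_emb[OF assms(2,1), of "\<lambda>i. {w i}"] by (simp add: bits_def)
qed

text \<open>A rectangle of coin events restricts each coordinate to the empty set, to one value or
  not at all. Point cylinders therefore determine the law, and \<open>cyl\<close> is all that the
  applications have to compute.\<close>

lemma (in prob_space) distr_eq_bitsI:
  assumes X [measurable]: "X \<in> M \<rightarrow>\<^sub>M bits I"
    and cyl: "\<And>J w. finite J \<Longrightarrow> J \<subseteq> I \<Longrightarrow> prob {\<omega> \<in> space M. \<forall>i\<in>J. X \<omega> i = w i} = (1 / 2) ^ card J"
  shows "distr M (bits I) X = bits I"
proof -
  have comp [measurable]: "Measurable.pred M (\<lambda>\<omega>. X \<omega> i)" if "i \<in> I" for i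
    using measurable_compose[OF X measurable_bits_component[OF that]] .
  have "bits I = distr M (bits I) X"
    unfolding bits_def
  proof (rule measure_eqI_PiM_infinite[OF refl])
    fix A J assume J: "finite J" "J \<subseteq> I" and A: "\<And>i. i \<in> J \<Longrightarrow> A i \<in> sets coin"
    have "prob {\<omega> \<in> space M. \<forall>i\<in>J. X \<omega> i \<in> A i} = (\<Prod>i\<in>J. measure coin (A i))"
    proof (cases "\<exists>i\<in>J. A i = {}")
      case True
      then have "{\<omega> \<in> space M. \<forall>i\<in>J. X \<omega> i \<in> A i} = {}" by auto
      moreover have "(\<Prod>i\<in>J. measure coin (A i)) = 0"
        using True J by (metis measure_empty prod_zero)
      ultimately show ?thesis by (simp only: measure_empty)
    next
      case False
      define K where "K = {i \<in> J. A i \<noteq> UNIV}"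
      \<comment> \<open>A set of booleans that is neither empty nor everything is a singleton; its
        element is the truth value of \<open>True \<in> A i\<close>.\<close>
      have K: "x \<in> A i \<longleftrightarrow> x = (True \<in> A i)" if i: "i \<in> K" for x i
      proof -
        obtain u v where uv: "u \<in> A i" "v \<notin> A i" using i False unfolding K_def by blast
        then show ?thesis by (cases x; cases u; cases v) auto
      qed
      have K': "measure coin (A i) = 1 / 2" if i: "i \<in> K" for i
      proof -
        have "A i = {True \<in> A i}" using K[OF i] by blast
        then show ?thesis using measure_coin_singleton by metis
      qed
      have "X \<omega> i \<in> A i \<longleftrightarrow> (i \<in> K \<longrightarrow> X \<omega> i = (True \<in> A i))" if "i \<in> J" for \<omega> i
        using that K[of i "X \<omega> i"] by (cases "i \<in> K") (simp_all add: K_def)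
      then have "(\<forall>i\<in>J. X \<omega> i \<in> A i) \<longleftrightarrow> (\<forall>i\<in>K. X \<omega> i = (True \<in> A i))" for \<omega>
        unfolding K_def by blast
      then have "prob {\<omega> \<in> space M. \<forall>i\<in>J. X \<omega> i \<in> A i} = (1 / 2) ^ card K"
        using cyl[of K] J by (simp add: K_def subset_iff)
      also have "\<dots> = (\<Prod>i\<in>K. measure coin (A i))"
        by (subst prod.cong[OF refl K']) simp_all
      also have "\<dots> = (\<Prod>i\<in>J. measure coin (A i))"
        using J by (intro prod.mono_neutral_left) (auto simp: K_def)
      finally show ?thesis .
    qed
    moreover have "X -` prod_emb I (\<lambda>_. coin) J (Pi\<^sub>E J A) \<inter> space M
        = {\<omega> \<in> space M. \<forall>i\<in>J. X \<omega> i \<in> A i}"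
      using measurable_space[OF X] by (auto simp: prod_emb_def space_PiM bits_def)
    ultimately have "emeasure (distr M (Pi\<^sub>M I (\<lambda>_. coin)) X) (prod_emb I (\<lambda>_. coin) J (Pi\<^sub>E J A))
        = ennreal (\<Prod>i\<in>J. measure coin (A i))"
      using X J A by (subst emeasure_distr)
        (auto simp: bits_def emeasure_eq_measure intro!: sets_PiM_I)
    also have "\<dots> = emeasure (Pi\<^sub>M I (\<lambda>_. coin)) (prod_emb I (\<lambda>_. coin) J (Pi\<^sub>E J A))"
      using J A by (subst emeasure_PiM_emb)
        (auto intro: prob_space_coin simp: finite_measure.emeasure_eq_measure
          prob_space.finite_measure[OF prob_space_coin] prod_ennreal)
    finally show "emeasure (Pi\<^sub>M I (\<lambda>_. coin)) (prod_emb I (\<lambda>_. coin) J (Pi\<^sub>E J A))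
      = emeasure (distr M (Pi\<^sub>M I (\<lambda>_. coin)) X) (prod_emb I (\<lambda>_. coin) J (Pi\<^sub>E J A))" ..
  next
    show "finite_measure (Pi\<^sub>M I (\<lambda>_. coin))"
      using prob_space_bits[of I] by (simp add: bits_def prob_space_def)
  qed simp
  then show ?thesis ..
qed

text \<open>An injective selection of coins followed by a fixed pattern of flips again yields fair
  coins. One statement serves translations (\<open>s\<close> constantly false) as well as label
  flips and random flips (\<open>p = id\<close>).\<close>

lemma distr_bits_transform:
  assumes "inj_on p I" "p ` I \<subseteq> K"
  shows "(\<lambda>\<omega>. \<lambda>i\<in>I. \<omega> (p i) \<noteq> s i) \<in> bits K \<rightarrow>\<^sub>M bits I"
    and "distr (bits K) (bits I) (\<lambda>\<omega>. \<lambda>i\<in>I. \<omega> (p i) \<noteq> s i) = bits I"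
proof -
  interpret prob_space "bits K" by (rule prob_space_bits)
  have [measurable]: "Measurable.pred (bits K) (\<lambda>\<omega>. \<omega> (p i))" if "i \<in> I" for i
    using that assms(2) by (intro measurable_bits_component) auto
  show meas: "(\<lambda>\<omega>. \<lambda>i\<in>I. \<omega> (p i) \<noteq> s i) \<in> bits K \<rightarrow>\<^sub>M bits I"
    by (intro measurable_bitsI) auto
  show "distr (bits K) (bits I) (\<lambda>\<omega>. \<lambda>i\<in>I. \<omega> (p i) \<noteq> s i) = bits I"
  proof (rule distr_eq_bitsI[OF meas])
    fix J w assume J: "finite J" "J \<subseteq> I"
    define q where "q = the_inv_into I p"
    have q: "q (p i) = i" if "i \<in> I" for i
      unfolding q_def using assms(1) that by (rule the_inv_into_f_f)
    have "prob {\<omega> \<in> space (bits K). \<forall>i\<in>J. (\<lambda>i\<in>I. \<omega> (p i) \<noteq> s i) i = w i}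
      = prob {\<omega> \<in> space (bits K). \<forall>j\<in>p ` J. \<omega> j = (w (q j) \<noteq> s (q j))}"
      using J q by (intro arg_cong[where f = prob]) (auto simp: subset_iff)
    also have "\<dots> = (1 / 2) ^ card (p ` J)"
      using J assms(2) by (intro measure_bits_cylinder) auto
    also have "card (p ` J) = card J"
      using J assms(1) inj_on_subset by (intro card_image) blast
    finally show "prob {\<omega> \<in> space (bits K). \<forall>i\<in>J. (\<lambda>i\<in>I. \<omega> (p i) \<noteq> s i) i = w i}
      = (1 / 2) ^ card J" .
  qed
qed

lemma measure_pair_Times:
  assumes "prob_space M" "prob_space N" "A \<in> sets M" "B \<in> sets N"
  shows "measure (M \<Otimes>\<^sub>M N) (A \<times> B) = measure M A * measure N B"
proof -
  interpret M: prob_space M by fact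
  interpret N: prob_space N by fact
  show ?thesis using N.emeasure_pair_measure_Times[OF assms(3,4)]
    by (simp add: measure_def enn2real_mult)
qed

section \<open>Resampling a part of the coins\<close>

text \<open>Keeps the coins in \<open>A\<close> and redraws the others from a second, independent
  field. This plays the role of conditioning on the coins in \<open>A\<close> without splitting the
  index set into two product spaces.\<close>

definition mix :: "'i set \<Rightarrow> 'i set \<Rightarrow> ('i \<Rightarrow> bool) \<Rightarrow> ('i \<Rightarrow> bool) \<Rightarrow> 'i \<Rightarrow> bool" where
  "mix I A \<omega> \<omega>' = (\<lambda>i\<in>I. if i \<in> A then \<omega> i else \<omega>' i)"

lemma measurable_mix:
  "(\<lambda>(\<omega>, \<omega>'). mix I A \<omega> \<omega>') \<in> bits I \<Otimes>\<^sub>M bits I \<rightarrow>\<^sub>M bits I"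
proof (rule measurable_bitsI)
  fix i assume "i \<in> I"
  then have [measurable]: "Measurable.pred (bits I) (\<lambda>\<omega>. \<omega> i)" by (rule measurable_bits_component)
  show "Measurable.pred (bits I \<Otimes>\<^sub>M bits I) (\<lambda>x. (case x of (\<omega>, \<omega>') \<Rightarrow> mix I A \<omega> \<omega>') i)"
    using \<open>i \<in> I\<close> by (cases "i \<in> A") (simp_all add: mix_def case_prod_beta)
qed (auto simp: mix_def)

lemma distr_mix:
  "distr (bits I \<Otimes>\<^sub>M bits I) (bits I) (\<lambda>(\<omega>, \<omega>'). mix I A \<omega> \<omega>') = bits I"
proof -
  interpret B: prob_space "bits I" by (rule prob_space_bits)
  interpret pair_prob_space "bits I" "bits I" ..
  show ?thesis
  proof (rule distr_eq_bitsI[OF measurable_mix])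
    fix J w assume J: "finite J" "J \<subseteq> I"
    have fin: "finite (J \<inter> A)" "finite (J - A)" using J by auto
    have sub: "J \<inter> A \<subseteq> I" "J - A \<subseteq> I" using J by auto
    have [measurable]: "Measurable.pred (bits I) (\<lambda>\<omega>. \<omega> i)" if "i \<in> J" for i
      using that J(2) by (intro measurable_bits_component) auto
    have sets: "{\<omega> \<in> space (bits I). \<forall>i\<in>J \<inter> A. \<omega> i = w i} \<in> sets (bits I)"
      "{\<omega> \<in> space (bits I). \<forall>i\<in>J - A. \<omega> i = w i} \<in> sets (bits I)"
      by (rule sets_bits_cylinder[OF fin(1) sub(1)] sets_bits_cylinder[OF fin(2) sub(2)])+
    have "measure (bits I \<Otimes>\<^sub>M bits I)
        {x \<in> space (bits I \<Otimes>\<^sub>M bits I). \<forall>i\<in>J. (case x of (\<omega>, \<omega>') \<Rightarrow> mix I A \<omega> \<omega>') i = w i}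
      = measure (bits I \<Otimes>\<^sub>M bits I) ({\<omega> \<in> space (bits I). \<forall>i\<in>J \<inter> A. \<omega> i = w i}
        \<times> {\<omega> \<in> space (bits I). \<forall>i\<in>J - A. \<omega> i = w i})"
      using J by (intro arg_cong[where f = "measure _"])
        (auto simp: space_pair_measure mix_def subset_iff split: if_splits)
    also have "\<dots> = measure (bits I) {\<omega> \<in> space (bits I). \<forall>i\<in>J \<inter> A. \<omega> i = w i} *
        measure (bits I) {\<omega> \<in> space (bits I). \<forall>i\<in>J - A. \<omega> i = w i}"
      by (rule measure_pair_Times[OF prob_space_bits prob_space_bits sets])
    also have "\<dots> = (1 / 2) ^ (card (J \<inter> A) + card (J - A))"
      by (simp only: measure_bits_cylinder[OF fin(1) sub(1)] measure_bits_cylinder[OF fin(2) sub(2)]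
        power_add)
    also have "card (J \<inter> A) + card (J - A) = card J"
      using card_Diff_subset_Int[of J A] J(1) card_mono[of J "J \<inter> A"] by simp
    finally show "measure (bits I \<Otimes>\<^sub>M bits I)
        {x \<in> space (bits I \<Otimes>\<^sub>M bits I). \<forall>i\<in>J. (case x of (\<omega>, \<omega>') \<Rightarrow> mix I A \<omega> \<omega>') i = w i}
      = (1 / 2) ^ card J" .
  qed
qed

lemma prob_le_by_mix:
  fixes c :: real
  assumes P [measurable]: "Measurable.pred (bits I) P" and Q [measurable]: "Measurable.pred (bits I) Q"
    and c: "0 \<le> c"
    and le: "\<And>\<omega>. \<omega> \<in> space (bits I) \<Longrightarrow> Q \<omega> \<Longrightarrow>
      measure (bits I) {\<omega>' \<in> space (bits I). P (mix I A \<omega> \<omega>')} \<le> c"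
    and imp: "\<And>\<omega> \<omega>'. \<omega> \<in> space (bits I) \<Longrightarrow> \<omega>' \<in> space (bits I) \<Longrightarrow> P (mix I A \<omega> \<omega>') \<Longrightarrow> Q \<omega>"
  shows "measure (bits I) {\<omega> \<in> space (bits I). P \<omega>} \<le> c * measure (bits I) {\<omega> \<in> space (bits I). Q \<omega>}"
proof -
  interpret B: prob_space "bits I" by (rule prob_space_bits)
  interpret pair_prob_space "bits I" "bits I" ..
  let ?B = "bits I"
  have mm: "(\<lambda>(\<omega>, \<omega>'). mix I A \<omega> \<omega>') \<in> ?B \<Otimes>\<^sub>M ?B \<rightarrow>\<^sub>M ?B" by (rule measurable_mix)
  have SP: "{\<omega> \<in> space ?B. P \<omega>} \<in> sets ?B" by (rule predE[OF P])
  have SP': "(\<lambda>(\<omega>, \<omega>'). mix I A \<omega> \<omega>') -` {\<omega> \<in> space ?B. P \<omega>} \<inter> space (?B \<Otimes>\<^sub>M ?B)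
      \<in> sets (?B \<Otimes>\<^sub>M ?B)" by (rule measurable_sets[OF mm SP])
  have "emeasure ?B {\<omega> \<in> space ?B. P \<omega>}
    = emeasure (distr (?B \<Otimes>\<^sub>M ?B) ?B (\<lambda>(\<omega>, \<omega>'). mix I A \<omega> \<omega>')) {\<omega> \<in> space ?B. P \<omega>}"
    by (simp only: distr_mix)
  also have "\<dots> = emeasure (?B \<Otimes>\<^sub>M ?B)
      ((\<lambda>(\<omega>, \<omega>'). mix I A \<omega> \<omega>') -` {\<omega> \<in> space ?B. P \<omega>} \<inter> space (?B \<Otimes>\<^sub>M ?B))"
    by (rule emeasure_distr[OF mm SP])
  also have "\<dots> = (\<integral>\<^sup>+\<omega>. emeasure ?B {\<omega>' \<in> space ?B. P (mix I A \<omega> \<omega>')} \<partial>?B)"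
    unfolding B.emeasure_pair_measure_alt[OF SP']
    by (intro nn_integral_cong arg_cong2[where f = emeasure])
      (auto simp: space_pair_measure mix_def space_bits)
  also have "\<dots> \<le> (\<integral>\<^sup>+\<omega>. ennreal c * indicator {\<omega> \<in> space ?B. Q \<omega>} \<omega> \<partial>?B)"
  proof (rule nn_integral_mono)
    fix \<omega> assume \<omega>: "\<omega> \<in> space ?B"
    show "emeasure ?B {\<omega>' \<in> space ?B. P (mix I A \<omega> \<omega>')} \<le> ennreal c * indicator {\<omega> \<in> space ?B. Q \<omega>} \<omega>"
    proof (cases "Q \<omega>")
      case True
      then show ?thesis using le[OF \<omega>] \<omega> c by (simp add: B.emeasure_eq_measure ennreal_leI)
    next
      case False
      then have "{\<omega>' \<in> space ?B. P (mix I A \<omega> \<omega>')} = {}" using imp[OF \<omega>] by auto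
      then show ?thesis by (simp only: emeasure_empty zero_le)
    qed
  qed
  also have "\<dots> = ennreal c * emeasure ?B {\<omega> \<in> space ?B. Q \<omega>}"
    by (rule nn_integral_cmult_indicator[OF predE[OF Q]])
  finally show ?thesis using c by (simp add: B.emeasure_eq_measure flip: ennreal_mult)
qed

text \<open>Dependence on disjoint sets of coins is expressed by \<open>PA\<close> and
  \<open>QA\<close>: \<open>P\<close> ignores what is redrawn and \<open>Q\<close> ignores what is
  kept. The preimage of the joint event under \<open>mix\<close> is then a rectangle.\<close>

lemma prob_conj_bits_disjoint:
  assumes P [measurable]: "Measurable.pred (bits I) P" and Q [measurable]: "Measurable.pred (bits I) Q"
    and PA: "\<And>\<omega> \<omega>'. \<omega> \<in> space (bits I) \<Longrightarrow> \<omega>' \<in> space (bits I) \<Longrightarrow> P (mix I A \<omega> \<omega>') \<longleftrightarrow> P \<omega>"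
    and QA: "\<And>\<omega> \<omega>'. \<omega> \<in> space (bits I) \<Longrightarrow> \<omega>' \<in> space (bits I) \<Longrightarrow> Q (mix I A \<omega> \<omega>') \<longleftrightarrow> Q \<omega>'"
  shows "measure (bits I) {\<omega> \<in> space (bits I). P \<omega> \<and> Q \<omega>}
    = measure (bits I) {\<omega> \<in> space (bits I). P \<omega>} * measure (bits I) {\<omega> \<in> space (bits I). Q \<omega>}"
proof -
  interpret B: prob_space "bits I" by (rule prob_space_bits)
  interpret pair_prob_space "bits I" "bits I" ..
  let ?B = "bits I"
  have mm: "(\<lambda>(\<omega>, \<omega>'). mix I A \<omega> \<omega>') \<in> ?B \<Otimes>\<^sub>M ?B \<rightarrow>\<^sub>M ?B" by (rule measurable_mix)
  have "measure ?B {\<omega> \<in> space ?B. P \<omega> \<and> Q \<omega>}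
    = measure (distr (?B \<Otimes>\<^sub>M ?B) ?B (\<lambda>(\<omega>, \<omega>'). mix I A \<omega> \<omega>')) {\<omega> \<in> space ?B. P \<omega> \<and> Q \<omega>}"
    by (simp only: distr_mix)
  also have "\<dots> = measure (?B \<Otimes>\<^sub>M ?B)
      ((\<lambda>(\<omega>, \<omega>'). mix I A \<omega> \<omega>') -` {\<omega> \<in> space ?B. P \<omega> \<and> Q \<omega>} \<inter> space (?B \<Otimes>\<^sub>M ?B))"
    by (rule measure_distr[OF mm predE]) (rule pred_intros_logic P Q)+
  also have "(\<lambda>(\<omega>, \<omega>'). mix I A \<omega> \<omega>') -` {\<omega> \<in> space ?B. P \<omega> \<and> Q \<omega>} \<inter> space (?B \<Otimes>\<^sub>M ?B)
      = {\<omega> \<in> space ?B. P \<omega>} \<times> {\<omega> \<in> space ?B. Q \<omega>}"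
  proof -
    have "mix I A \<omega> \<omega>' \<in> space ?B" for \<omega> \<omega>' by (auto simp: mix_def space_bits)
    then show ?thesis using PA QA by (auto simp: space_pair_measure)
  qed
  also have "measure (?B \<Otimes>\<^sub>M ?B) \<dots>
      = measure ?B {\<omega> \<in> space ?B. P \<omega>} * measure ?B {\<omega> \<in> space ?B. Q \<omega>}"
    by (rule measure_pair_Times[OF prob_space_bits prob_space_bits predE[OF P] predE[OF Q]])
  finally show ?thesis .
qed

lemma emeasure_distr_nn_integral:
  assumes "f \<in> M \<rightarrow>\<^sub>M N" "A \<in> sets N"
  shows "emeasure (distr M N f) A = (\<integral>\<^sup>+x. indicator A (f x) \<partial>M)"
  using nn_integral_distr[OF assms(1), of "indicator A"] assms(2) by simp

text \<open>Average over a random flip \<open>s\<close> independent of \<open>X\<close>. For each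
  fixed \<open>s\<close> the law is unchanged by \<open>inv\<close>, while for each fixed value of
  \<open>X\<close> the flipped sequence is a field of fair coins; Fubini equates the two. This is
  the uniqueness of Haar measure on a power of the group with two elements.\<close>

lemma distr_eq_bits_if_xor_invariant:
  assumes X [measurable]: "X \<in> M \<rightarrow>\<^sub>M bits I" and "prob_space M"
    and inv: "\<And>s. distr M (bits I) (\<lambda>\<omega>. \<lambda>i\<in>I. X \<omega> i \<noteq> s i) = distr M (bits I) X"
  shows "distr M (bits I) X = bits I"
proof (rule measure_eqI)
  interpret M: prob_space M by fact
  interpret B: prob_space "bits I" by (rule prob_space_bits)
  interpret pair_prob_space M "bits I" ..
  fix A assume "A \<in> sets (distr M (bits I) X)"
  then have A [measurable]: "A \<in> sets (bits I)" by simp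
  let ?f = "\<lambda>\<omega> s. \<lambda>i\<in>I. X \<omega> i \<noteq> s i"
  have comp [measurable]: "Measurable.pred M (\<lambda>\<omega>. X \<omega> i)" if "i \<in> I" for i
    using measurable_compose[OF X measurable_bits_component[OF that]] .
  have f [measurable]: "(\<lambda>(\<omega>, s). ?f \<omega> s) \<in> M \<Otimes>\<^sub>M bits I \<rightarrow>\<^sub>M bits I"
    by (rule measurable_bitsI) (auto simp: case_prod_beta)
  have Xs: "?f \<omega> s \<in> space (bits I)" for \<omega> s by (auto simp: space_bits)
  have f1 [measurable]: "(\<lambda>\<omega>. ?f \<omega> s) \<in> M \<rightarrow>\<^sub>M bits I" for s
    by (rule measurable_bitsI) auto
  have f2 [measurable]: "?f \<omega> \<in> bits I \<rightarrow>\<^sub>M bits I" for \<omega>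
    by (rule measurable_bitsI) auto
  have d2: "distr (bits I) (bits I) (?f \<omega>) = bits I" for \<omega>
  proof -
    have "?f \<omega> = (\<lambda>s. \<lambda>i\<in>I. s (id i) \<noteq> X \<omega> i)" by (auto simp: fun_eq_iff)
    then show ?thesis using distr_bits_transform(2)[of id I I] by simp
  qed
  have "emeasure (distr M (bits I) X) A
      = (\<integral>\<^sup>+s. emeasure (distr M (bits I) (\<lambda>\<omega>. ?f \<omega> s)) A \<partial>bits I)"
    unfolding inv by (simp add: B.emeasure_space_1)
  also have "\<dots> = (\<integral>\<^sup>+s. \<integral>\<^sup>+\<omega>. indicator A (?f \<omega> s) \<partial>M \<partial>bits I)"
    by (intro nn_integral_cong emeasure_distr_nn_integral f1 A)
  also have "\<dots> = (\<integral>\<^sup>+\<omega>. \<integral>\<^sup>+s. indicator A (?f \<omega> s) \<partial>bits I \<partial>M)"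
  proof (rule Fubini')
    have eq: "(\<lambda>(\<omega>, s). indicator A (?f \<omega> s) :: ennreal) = (\<lambda>x. indicator A (case x of (\<omega>, s) \<Rightarrow> ?f \<omega> s))"
      by (simp add: fun_eq_iff)
    show "(\<lambda>(\<omega>, s). indicator A (?f \<omega> s) :: ennreal) \<in> borel_measurable (M \<Otimes>\<^sub>M bits I)"
      unfolding eq by (rule measurable_compose[OF f borel_measurable_indicator[OF A]])
  qed
  also have "\<dots> = (\<integral>\<^sup>+\<omega>. emeasure (distr (bits I) (bits I) (?f \<omega>)) A \<partial>M)"
    by (intro nn_integral_cong emeasure_distr_nn_integral[symmetric] f2 A)
  also have "\<dots> = emeasure (bits I) A" unfolding d2 by (simp add: M.emeasure_space_1)
  finally show "emeasure (distr M (bits I) X) A = emeasure (bits I) A" .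
qed simp

section \<open>Binary digits of a uniform random variable\<close>

text \<open>At 1 the second branch gives 1 again, so the closed interval is mapped into itself and 1
  gets the expansion with all digits one; 1/2 is read as a one followed by zeros.\<close>

definition doubling :: "real \<Rightarrow> real" where
  "doubling x = (if x < 1 / 2 then 2 * x else 2 * x - 1)"

definition digit :: "nat \<Rightarrow> real \<Rightarrow> bool" where
  "digit n x \<longleftrightarrow> 1 / 2 \<le> (doubling ^^ n) x"

definition binary_value :: "(nat \<Rightarrow> bool) \<Rightarrow> real" where
  "binary_value c = (\<Sum>k. of_bool (c k) * (1 / 2) ^ Suc k)"

lemma space_unit_interval [simp]: "space unit_interval = {0..1}"
  by (simp add: unit_interval_def space_restrict_space)

lemma prob_space_unit_interval: "prob_space unit_interval"
  by (rule prob_spaceI) (simp add: unit_interval_def emeasure_restrict_space space_restrict_space)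

lemma measurable_ident_unit_interval: "(\<lambda>x. x) \<in> unit_interval \<rightarrow>\<^sub>M borel"
  unfolding unit_interval_def by (rule measurable_restrict_space1) simp

lemma measurable_unit_interval_if_borel:
  assumes "f \<in> borel \<rightarrow>\<^sub>M M"
  shows "f \<in> unit_interval \<rightarrow>\<^sub>M M"
  using measurable_compose[OF measurable_ident_unit_interval assms] .

lemma measurable_doubling [measurable]: "doubling \<in> borel \<rightarrow>\<^sub>M borel"
  unfolding doubling_def by measurable

lemma measurable_doubling_pow [measurable]: "doubling ^^ n \<in> borel \<rightarrow>\<^sub>M borel"
proof (induction n)
  case (Suc n)
  then show ?case using measurable_compose[OF Suc measurable_doubling] by (simp add: comp_def)
qed (simp add: id_def)

lemma measurable_digit [measurable]: "Measurable.pred borel (digit n)"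
proof -
  have "Measurable.pred borel (\<lambda>x. 1 / 2 \<le> (doubling ^^ n) x)"
    by (rule measurable_compose[OF measurable_doubling_pow]) simp
  then show ?thesis by (simp add: digit_def[abs_def])
qed

lemma doubling_in_unit: "x \<in> {0..1} \<Longrightarrow> doubling x \<in> {0..1}"
  by (auto simp: doubling_def)

lemma doubling_pow_in_unit: "x \<in> {0..1} \<Longrightarrow> (doubling ^^ n) x \<in> {0..1}"
proof (induction n)
  case (Suc n)
  then show ?case using doubling_in_unit[OF Suc.IH[OF Suc.prems]] by simp
qed simp

lemma sets_borel_unit_Collect:
  assumes "Measurable.pred borel P"
  shows "{x \<in> {0..1 :: real}. P x} \<in> sets borel"
proof -
  have eq: "{x \<in> {0..1 :: real}. P x} = {0..1} \<inter> {x \<in> space borel. P x}" by auto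
  show ?thesis unfolding eq by (intro sets.Int predE assms) simp
qed

lemma sets_unit_interval_Collect:
  assumes "Measurable.pred borel P"
  shows "{x \<in> {0..1}. P x} \<in> sets unit_interval"
proof -
  have S: "{0..1} \<inter> space lborel \<in> sets (lborel :: real measure)" by simp
  have "{x \<in> {0..1}. P x} \<subseteq> {0..1}" by blast
  then show ?thesis
    unfolding unit_interval_def sets_restrict_space_iff[OF S]
    using sets_borel_unit_Collect[OF assms] unfolding sets_lborel by blast
qed

lemma pred_eq_const:
  assumes "Measurable.pred M P"
  shows "Measurable.pred M (\<lambda>x. P x = b)"
  by (rule measurable_compose[OF assms]) (rule measurable_count_space)

lemma pred_half_and_doubling:
  assumes "Measurable.pred borel Q"
  shows "Measurable.pred borel (\<lambda>x. (1 / 2 \<le> x) = b \<and> Q (doubling x))"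
proof -
  have half: "Measurable.pred borel (\<lambda>x::real. 1 / 2 \<le> x)"
    using atLeast_borel[of "1 / 2 :: real"] by (simp add: pred_def atLeast_def)
  show ?thesis
    by (rule pred_intros_logic(3)[OF pred_eq_const[OF half] measurable_compose[OF measurable_doubling assms]])
qed

text \<open>Each half of the interval is stretched by the factor 2 onto the whole interval, up to
  one endpoint, so the first digit is independent of the rest of the expansion.\<close>

lemma measure_half_and_doubling:
  assumes Q: "Measurable.pred borel Q"
  shows "measure unit_interval {x \<in> {0..1}. (1 / 2 \<le> x) = b \<and> Q (doubling x)}
    = 1 / 2 * measure unit_interval {x \<in> {0..1}. Q x}"
proof -
  have eq: "measure unit_interval A = measure lborel A" if "A \<subseteq> {0..1}" for A
    unfolding unit_interval_def using that by (intro measure_restrict_space) auto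
  define D where "D = {x \<in> {0..1}. (1 / 2 \<le> x) = b \<and> Q (doubling x)}"
  define R where "R = {x \<in> {0..1}. Q x}"
  have [measurable]: "D \<in> sets borel" "R \<in> sets borel" unfolding D_def R_def
    by (intro sets_borel_unit_Collect pred_half_and_doubling Q)+
  define t :: real where "t = of_bool b / 2"
  \<comment> \<open>The point 1 is discarded because the lower inverse branch sends it to 1/2, which
    belongs to the upper half.\<close>
  have ae: "AE x in lborel. indicator D (t + 1 / 2 * x) = (indicator R x :: ennreal)"
    using AE_lborel_singleton[of 1]
  proof eventually_elim
    case (elim x)
    show ?case
    proof (cases b)
      case True
      then have "t + 1 / 2 * x \<in> D \<longleftrightarrow> x \<in> R"
        by (auto simp: D_def R_def t_def doubling_def field_simps)
      then show ?thesis by (simp add: indicator_def)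
    next
      case False
      then have "t + 1 / 2 * x \<in> D \<longleftrightarrow> x \<in> R"
        using elim by (auto simp: D_def R_def t_def doubling_def field_simps)
      then show ?thesis by (simp add: indicator_def)
    qed
  qed
  have "(\<integral>\<^sup>+x. indicator D x \<partial>lborel) = ennreal \<bar>1 / 2\<bar> * (\<integral>\<^sup>+x. indicator D (t + 1 / 2 * x) \<partial>lborel)"
    by (rule nn_integral_real_affine[where f = "indicator D" and c = "1 / 2" and t = t])
      (rule borel_measurable_indicator[OF \<open>D \<in> sets borel\<close>], simp)
  also have "(\<integral>\<^sup>+x. indicator D (t + 1 / 2 * x) \<partial>lborel) = (\<integral>\<^sup>+x. indicator R x \<partial>lborel)"
    by (rule nn_integral_cong_AE[OF ae])
  finally have "emeasure lborel D = ennreal (1 / 2) * emeasure lborel R"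
    by (simp only: nn_integral_indicator sets_lborel \<open>D \<in> sets borel\<close> \<open>R \<in> sets borel\<close>) simp
  then have "measure lborel D = enn2real (ennreal (1 / 2)) * measure lborel R"
    by (simp only: measure_def enn2real_mult)
  also have "enn2real (ennreal (1 / 2)) = 1 / 2" by (rule enn2real_ennreal) simp
  finally have "measure lborel D = 1 / 2 * measure lborel R" .
  moreover have "D \<subseteq> {0..1}" "R \<subseteq> {0..1}" by (auto simp: D_def R_def)
  ultimately have "measure unit_interval D = 1 / 2 * measure unit_interval R"
    using eq by (simp only:)
  then show ?thesis unfolding D_def R_def .
qed

text \<open>Induction strips off the leading digit, which shifts \<open>J\<close> and
  \<open>w\<close> by one; hence both are arbitrary. Positions outside \<open>J\<close> are free,
  and a free leading digit brings in both halves of the interval.\<close>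

lemma measure_digits_cylinder:
  "measure unit_interval {x \<in> {0..1}. \<forall>i<n. i \<in> J \<longrightarrow> digit i x = w i}
    = (\<Prod>i<n. if i \<in> J then 1 / 2 else 1)"
proof (induction n arbitrary: J w)
  case 0
  have "{x \<in> {0..1 :: real}. \<forall>i<0. i \<in> J \<longrightarrow> digit i x = w i} = space unit_interval" by auto
  then show ?case using prob_space.prob_space[OF prob_space_unit_interval]
    by (simp only: lessThan_0 prod.empty)
next
  case (Suc n)
  interpret prob_space unit_interval by (rule prob_space_unit_interval)
  define Q where "Q x \<longleftrightarrow> (\<forall>i<n. i \<in> {i. Suc i \<in> J} \<longrightarrow> digit i x = w (Suc i))" for x
  have Q: "Measurable.pred borel Q" unfolding Q_def by measurable
  define D where "D b = {x \<in> {0..1}. (1 / 2 \<le> x) = b \<and> Q (doubling x)}" for b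
  have D: "measure unit_interval (D b) = 1 / 2 * (\<Prod>i<n. if Suc i \<in> J then 1 / 2 else 1)" for b
    unfolding D_def measure_half_and_doubling[OF Q] unfolding Q_def by (subst Suc.IH) simp
  have Dsets: "D b \<in> sets unit_interval" for b
    unfolding D_def by (intro sets_unit_interval_Collect pred_half_and_doubling Q)
  have digit_Suc: "digit (Suc i) x = digit i (doubling x)" for i x
    by (simp add: digit_def funpow_swap1)
  have digit_0: "digit 0 x \<longleftrightarrow> 1 / 2 \<le> x" for x by (simp add: digit_def)
  have eq: "{x \<in> {0..1}. \<forall>i<Suc n. i \<in> J \<longrightarrow> digit i x = w i}
    = (if 0 \<in> J then D (w 0) else D True \<union> D False)"
    unfolding All_less_Suc2 digit_Suc digit_0 D_def Q_def by (cases "0 \<in> J") (simp_all, blast+)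
  have "measure unit_interval (D True \<union> D False) = (\<Prod>i<n. if Suc i \<in> J then 1 / 2 else 1)"
  proof -
    have "D True \<inter> D False = {}" by (auto simp: D_def)
    then show ?thesis by (subst finite_measure_Union[OF Dsets Dsets]) (simp_all add: D)
  qed
  then show ?case unfolding eq prod.lessThan_Suc_shift by (simp add: D)
qed

lemma measure_digits:
  assumes "finite J"
  shows "measure unit_interval {x \<in> {0..1}. \<forall>i\<in>J. digit i x = w i} = (1 / 2) ^ card J"
proof -
  obtain n where n: "J \<subseteq> {..<n}" using assms finite_nat_iff_bounded by auto
  have "(\<Prod>i<n. if i \<in> J then 1 / 2 else 1) = (\<Prod>i\<in>J. 1 / 2 :: real)"
    using n by (simp add: prod.If_cases inf.absorb2)
  moreover have "{x \<in> {0..1}. \<forall>i\<in>J. digit i x = w i}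
      = {x \<in> {0..1}. \<forall>i<n. i \<in> J \<longrightarrow> digit i x = w i}" using n by auto
  ultimately show ?thesis by (simp only: measure_digits_cylinder prod_constant)
qed

lemma digits_sums:
  assumes "x \<in> {0..1}"
  shows "(\<lambda>k. of_bool (digit k x) * (1 / 2) ^ Suc k) sums x"
proof -
  have partial: "(\<Sum>k<n. of_bool (digit k x) * (1 / 2) ^ Suc k) = x - (doubling ^^ n) x * (1 / 2) ^ n" for n
  proof (induction n)
    case (Suc n)
    have step: "of_bool (digit n x) * (1 / 2) ^ Suc n
        = (doubling ^^ n) x * (1 / 2) ^ n - (doubling ^^ Suc n) x * (1 / 2) ^ Suc n"
      by (cases "digit n x") (simp_all add: digit_def doubling_def field_simps)
    have "x - a + (a - b) = x - b" for a b by simp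
    then show ?case unfolding sum.lessThan_Suc Suc.IH step .
  qed simp
  have "(\<lambda>n. (doubling ^^ n) x * (1 / 2) ^ n) \<longlonglongrightarrow> 0"
  proof (rule tendsto_sandwich)
    show "\<forall>\<^sub>F n in sequentially. 0 \<le> (doubling ^^ n) x * (1 / 2) ^ n"
      using doubling_pow_in_unit[OF assms] by auto
    show "\<forall>\<^sub>F n in sequentially. (doubling ^^ n) x * (1 / 2) ^ n \<le> (1 / 2) ^ n"
      using doubling_pow_in_unit[OF assms] by (auto intro!: mult_left_le_one_le)
    show "(\<lambda>n. (1 / 2) ^ n) \<longlonglongrightarrow> (0::real)" by (intro LIMSEQ_power_zero) simp
  qed simp
  then have "(\<lambda>n. x - (doubling ^^ n) x * (1 / 2) ^ n) \<longlonglongrightarrow> x - 0" by (intro tendsto_intros)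
  then show ?thesis unfolding sums_def partial by simp
qed

lemma measurable_digits: "(\<lambda>x n. digit n x) \<in> unit_interval \<rightarrow>\<^sub>M bits UNIV"
  by (intro measurable_bitsI measurable_unit_interval_if_borel measurable_digit) auto

lemma distr_digits: "distr unit_interval (bits UNIV) (\<lambda>x n. digit n x) = bits UNIV"
  using measure_digits
  by (intro prob_space.distr_eq_bitsI[OF prob_space_unit_interval measurable_digits]) simp

lemma binary_value_in_unit: "binary_value c \<in> {0..1}"
proof -
  have s: "(\<lambda>k. (1 / 2) ^ Suc k) sums (1 :: real)" using power_half_series .
  have le: "of_bool (c k) * (1 / 2) ^ Suc k \<le> (1 / 2 :: real) ^ Suc k" for k by simp
  have sm: "summable (\<lambda>k. of_bool (c k) * (1 / 2 :: real) ^ Suc k)"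
    by (rule summable_comparison_test'[OF sums_summable[OF s], of 0]) simp
  have "binary_value c \<le> (\<Sum>k. (1 / 2) ^ Suc k)"
    unfolding binary_value_def by (rule suminf_le[OF le sm sums_summable[OF s]])
  moreover have "0 \<le> binary_value c"
    unfolding binary_value_def by (rule suminf_nonneg[OF sm]) simp
  ultimately show ?thesis using sums_unique[OF s] by simp
qed

lemma measurable_binary_value: "binary_value \<in> bits UNIV \<rightarrow>\<^sub>M unit_interval"
proof -
  have "binary_value \<in> bits UNIV \<rightarrow>\<^sub>M borel"
    unfolding binary_value_def by (intro borel_measurable_suminf borel_measurable_times) measurable
  then show ?thesis
    unfolding unit_interval_def using binary_value_in_unit
    by (intro measurable_restrict_space2) auto
qed

text \<open>Reading digits turns the uniform law into fair coins, and \<open>binary_value\<close>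
  undoes the reading at every point of the interval, dyadic points included. The law is thus carried
  back with no exceptional set.\<close>

lemma distr_binary_value: "distr (bits UNIV) unit_interval binary_value = unit_interval"
proof -
  have "distr (bits UNIV) unit_interval binary_value
    = distr unit_interval unit_interval (binary_value \<circ> (\<lambda>x n. digit n x))"
    using distr_distr[OF measurable_binary_value measurable_digits] unfolding distr_digits .
  also have "\<dots> = distr unit_interval unit_interval (\<lambda>x. x)"
  proof (rule distr_cong)
    fix x assume "x \<in> space unit_interval"
    then show "(binary_value \<circ> (\<lambda>x n. digit n x)) x = x"
      using sums_unique[OF digits_sums[of x]] by (simp add: binary_value_def)
  qed simp_all
  also have "\<dots> = unit_interval" by (rule distr_id)
  finally show ?thesis .
qed

text \<open>One uniform variable per vertex is unfolded into one coin for each element of a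
  countable type: distinct \<open>k\<close> read distinct digits because \<open>to_nat\<close> is
  injective. Later \<open>k\<close> is a pair of a round and a position.\<close>

definition digit_field :: "'a set \<Rightarrow> ('a \<Rightarrow> real) \<Rightarrow> 'a \<times> 'k::countable \<Rightarrow> bool" where
  "digit_field V \<omega> = (\<lambda>(v, k)\<in>V \<times> UNIV. digit (to_nat k) (\<omega> v))"

lemma measurable_digit_field:
  "digit_field V \<in> (\<Pi>\<^sub>M v\<in>V. unit_interval) \<rightarrow>\<^sub>M bits (V \<times> (UNIV :: 'k::countable set))"
proof (rule measurable_bitsI)
  fix i :: "'a \<times> 'k" assume i: "i \<in> V \<times> UNIV"
  then have "(\<lambda>\<omega>. \<omega> (fst i)) \<in> (\<Pi>\<^sub>M v\<in>V. unit_interval) \<rightarrow>\<^sub>M unit_interval"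
    by (intro measurable_component_singleton) auto
  from measurable_compose[OF this measurable_unit_interval_if_borel[OF measurable_digit[of "to_nat (snd i)"]]]
  have "Measurable.pred (\<Pi>\<^sub>M v\<in>V. unit_interval) (\<lambda>\<omega>. digit (to_nat (snd i)) (\<omega> (fst i)))" .
  moreover have "digit_field V \<omega> i = digit (to_nat (snd i)) (\<omega> (fst i))" for \<omega>
    using i by (auto simp: digit_field_def)
  ultimately show "Measurable.pred (\<Pi>\<^sub>M v\<in>V. unit_interval) (\<lambda>\<omega>. digit_field V \<omega> i)"
    by (simp only:)
qed (auto simp: digit_field_def)

lemma distr_digit_field:
  "distr (\<Pi>\<^sub>M v\<in>V. unit_interval) (bits (V \<times> (UNIV :: 'k::countable set))) (digit_field V)
    = bits (V \<times> UNIV)"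
proof -
  interpret product_prob_space "\<lambda>_. unit_interval" V
    by (intro product_prob_spaceI prob_space_unit_interval)
  show ?thesis
  proof (rule distr_eq_bitsI[OF measurable_digit_field])
    fix J :: "('a \<times> 'k) set" and w :: "'a \<times> 'k \<Rightarrow> bool"
    assume J: "finite J" "J \<subseteq> V \<times> UNIV"
    define L where "L v = {k. (v, k) \<in> J}" for v
    define A where "A v = {x \<in> {0..1}. \<forall>i\<in>to_nat ` L v. digit i x = w (v, from_nat i)}" for v
    have JL: "J = Sigma (fst ` J) L" by (force simp: L_def)
    have finL: "finite (L v)" for v
    proof -
      have "L v \<subseteq> snd ` J" by (force simp: L_def)
      then show ?thesis using J(1) finite_subset by blast
    qed
    have sub: "fst ` J \<subseteq> V" using J by auto
    have A: "A v \<in> sets unit_interval" for v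
      unfolding A_def using finL
      by (intro sets_unit_interval_Collect pred_intros_finite pred_eq_const measurable_digit) auto
    have iff: "(\<forall>i\<in>J. digit_field V \<omega> i = w i) \<longleftrightarrow> (\<forall>v\<in>fst ` J. \<omega> v \<in> A v)"
      if "\<omega> \<in> space (\<Pi>\<^sub>M v\<in>V. unit_interval)" for \<omega>
    proof -
      have "\<omega> v \<in> A v \<longleftrightarrow> (\<forall>k\<in>L v. digit_field V \<omega> (v, k) = w (v, k))" if "v \<in> fst ` J" for v
      proof -
        have "v \<in> V" using that sub by auto
        moreover from this have "\<omega> v \<in> {0..1}"
          using \<open>\<omega> \<in> space _\<close> by (auto simp: space_PiM simp del: atLeastAtMost_iff)
        ultimately show ?thesis by (simp add: A_def digit_field_def)
      qed
      then show ?thesis by (subst JL) (simp add: Ball_def split_paired_All mem_Sigma_iff imp_conjL)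
    qed
    have "emb V (fst ` J) (Pi\<^sub>E (fst ` J) A)
        = {\<omega> \<in> space (\<Pi>\<^sub>M v\<in>V. unit_interval). \<forall>v\<in>fst ` J. \<omega> v \<in> A v}"
      unfolding prod_emb_def space_PiM vimage_def by (subst restrict_PiE_iff) blast
    then have "prob {\<omega> \<in> space (\<Pi>\<^sub>M v\<in>V. unit_interval). \<forall>i\<in>J. digit_field V \<omega> i = w i}
      = prob (emb V (fst ` J) (Pi\<^sub>E (fst ` J) A))"
      using iff by (intro arg_cong[where f = prob]) blast
    also have "\<dots> = (\<Prod>v\<in>fst ` J. measure unit_interval (A v))"
      using J(1) sub A by (intro measure_PiM_emb) auto
    also have "\<dots> = (\<Prod>v\<in>fst ` J. (1 / 2) ^ card (L v))"
      using finL unfolding A_def by (intro prod.cong refl, subst measure_digits) (auto simp: card_image)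
    also have "\<dots> = (1 / 2) ^ card J"
      using J(1) finL by (subst (2) JL) (simp add: power_sum card_SigmaI)
    finally show "prob {\<omega> \<in> space (\<Pi>\<^sub>M v\<in>V. unit_interval). \<forall>i\<in>J. digit_field V \<omega> i = w i}
      = (1 / 2) ^ card J" .
  qed
qed

section \<open>The cluster process\<close>

text \<open>The rate is a compromise: \<open>2\<close> to the power \<open>- precision m\<close> has to be summable, while
  \<open>4\<close> to the power \<open>precision m\<close> has to grow more slowly than the clusters, which typically have
  at least \<open>(5 / 4) ^ m\<close> vertices in round \<open>m\<close>.\<close>

definition precision :: "nat \<Rightarrow> nat" where
  "precision m = m div 20"

text \<open>The coins of a cluster are read at its root. Round \<open>m\<close> uses the coins \<open>b (r, Suc m, k)\<close>: the one
  with \<open>k = 0\<close> decides between head and tail, those with odd \<open>k\<close> decide whether the label is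
  replaced, and the remaining ones form the fresh label. The initial labels are \<open>fresh_label b 0\<close>.\<close>

definition is_head :: "('a \<times> nat \<times> nat \<Rightarrow> bool) \<Rightarrow> nat \<Rightarrow> 'a \<Rightarrow> bool" where
  "is_head b m r \<longleftrightarrow> b (r, Suc m, 0)"

definition is_flagged :: "('a \<times> nat \<times> nat \<Rightarrow> bool) \<Rightarrow> nat \<Rightarrow> 'a \<Rightarrow> bool" where
  "is_flagged b m r \<longleftrightarrow> (\<forall>i<precision m. b (r, Suc m, 2 * i + 1))"

definition fresh_label :: "('a \<times> nat \<times> nat \<Rightarrow> bool) \<Rightarrow> nat \<Rightarrow> 'a \<Rightarrow> nat \<Rightarrow> bool" where
  "fresh_label b m r = (\<lambda>i. b (r, m, 2 * i + 2))"

definition relabel ::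
  "('a \<times> nat \<times> nat \<Rightarrow> bool) \<Rightarrow> nat \<Rightarrow> ('a \<Rightarrow> nat \<Rightarrow> bool) \<Rightarrow> 'a \<Rightarrow> nat \<Rightarrow> bool" where
  "relabel b m L r = (if is_flagged b m r then fresh_label b (Suc m) r else L r)"

definition agree :: "nat \<Rightarrow> (nat \<Rightarrow> bool) \<Rightarrow> (nat \<Rightarrow> bool) \<Rightarrow> bool" where
  "agree n x y \<longleftrightarrow> (\<forall>i<n. x i = y i)"

text \<open>The positive even positions are those read by \<open>fresh_label\<close>. Flips along
  this mask change all fresh labels by \<open>s\<close> and leave the coins for head, tail and
  replacement alone.\<close>

definition label_mask :: "(nat \<Rightarrow> bool) \<Rightarrow> nat \<Rightarrow> bool" where
  "label_mask s k \<longleftrightarrow> (\<exists>i. k = 2 * i + 2 \<and> s i)"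

lemma label_mask_simps [simp]:
  "\<not> label_mask s 0" "\<not> label_mask s (Suc (2 * i))" "label_mask s (Suc (Suc (2 * i))) \<longleftrightarrow> s i"
  by (auto simp: label_mask_def) presburger

lemma sym_clust: "sym E \<Longrightarrow> sym (clust E L)"
  by (auto simp: clust_def sym_def)

locale tree_group = group G for G :: "('a, 'm) monoid_scheme" (structure) +
  fixes S :: "'a set"
  assumes countable_carrier: "countable (carrier G)"
    and generators: "S \<subseteq> carrier G"
    and regular: "regular_tree 3 (carrier G) (cayley_edges G S)"
begin

abbreviation V where "V \<equiv> carrier G"
abbreviation E where "E \<equiv> cayley_edges G S"

lemma E_subset: "E \<subseteq> V \<times> V" and sym_E: "sym E" and irrefl_E: "irrefl E"
  and acyclic_E: "\<nexists>xs. graph_cycle E xs"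
  using regular by (auto simp: regular_tree_def is_tree_def simple_graph_def)

lemma degree_E: "x \<in> V \<Longrightarrow> finite {y. (x, y) \<in> E} \<and> card {y. (x, y) \<in> E} = 3"
  using regular by (auto simp: regular_tree_def)

lemma inv_mult_translate:
  assumes "g \<in> V" "x \<in> V" "y \<in> V"
  shows "inv (g \<otimes> x) \<otimes> (g \<otimes> y) = inv x \<otimes> y"
proof -
  have "inv (g \<otimes> x) \<otimes> (g \<otimes> y) = inv x \<otimes> (inv g \<otimes> (g \<otimes> y))"
    using assms by (simp add: inv_mult_group m_assoc)
  also have "inv g \<otimes> (g \<otimes> y) = y" using assms by (simp flip: m_assoc)
  finally show ?thesis .
qed

lemma E_iff: "(x, y) \<in> E \<longleftrightarrow> x \<in> V \<and> y \<in> V \<and> inv x \<otimes> y \<in> S"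
proof
  assume "(x, y) \<in> E"
  then obtain s where "x \<in> V" "s \<in> S" "y = x \<otimes> s" by (auto simp: cayley_edges_def)
  then show "x \<in> V \<and> y \<in> V \<and> inv x \<otimes> y \<in> S"
    using generators by (auto simp flip: m_assoc)
next
  assume *: "x \<in> V \<and> y \<in> V \<and> inv x \<otimes> y \<in> S"
  then have "y = x \<otimes> (inv x \<otimes> y)" by (simp flip: m_assoc)
  then show "(x, y) \<in> E" using * unfolding cayley_edges_def by blast
qed

lemma E_translate:
  "g \<in> V \<Longrightarrow> x \<in> V \<Longrightarrow> y \<in> V \<Longrightarrow> (g \<otimes> x, g \<otimes> y) \<in> E \<longleftrightarrow> (x, y) \<in> E"
  by (simp add: E_iff inv_mult_translate)

lemma image_translate_carrier: "g \<in> V \<Longrightarrow> (\<otimes>) g ` V = V"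
  by (rule surj_const_mult)

lemma translate_cases:
  assumes "g \<in> V" "z \<in> V" obtains y where "y \<in> V" "z = g \<otimes> y"
  using image_translate_carrier[OF assms(1)] assms(2) by blast

section \<open>One round of merging\<close>

definition candidates where
  "candidates b m \<rho> r = {y \<in> V. \<rho> y \<noteq> r \<and> is_head b m (\<rho> y) \<and> (\<exists>x\<in>V. \<rho> x = r \<and> (x, y) \<in> E)}"

definition close_candidates where
  "close_candidates b m \<rho> L r = {y \<in> candidates b m \<rho> r.
     agree (precision m) (relabel b m L (\<rho> y)) (relabel b m L r)}"

text \<open>The fallback to all candidates makes every tail cluster with an adjacent head merge,
  whatever the labels are. Whether a cluster merges is thus decided by the head coins alone.\<close>

definition pool where
  "pool b m \<rho> L r = (if close_candidates b m \<rho> L r = {} then candidates b m \<rho> r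
     else close_candidates b m \<rho> L r)"

text \<open>Ties are broken by the position relative to the root, in an enumeration of the group, so that the
  choice commutes with translations.\<close>

definition is_choice where
  "is_choice b m \<rho> L r y \<longleftrightarrow> y \<in> pool b m \<rho> L r \<and> (\<forall>z\<in>pool b m \<rho> L r.
     to_nat_on V (inv r \<otimes> y) \<le> to_nat_on V (inv r \<otimes> z))"

text \<open>Heads keep their root, so a tail cluster that moves lands on a root that stays fixed in
  this round. One application of \<open>target\<close> completes the merger; there are no chains to
  follow.\<close>

definition target where
  "target b m \<rho> L r = (if is_head b m r \<or> candidates b m \<rho> r = {} then r
     else \<rho> (SOME y. is_choice b m \<rho> L r y))"

text \<open>A partition into clusters is stored as the map to root vertices. The new label is read
  at the new root, which is how a tail cluster takes over the label of its head; if it moves, a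
  replacement at its own old root only influences which head it prefers.\<close>

primrec state :: "('a \<times> nat \<times> nat \<Rightarrow> bool) \<Rightarrow> nat \<Rightarrow> ('a \<Rightarrow> 'a) \<times> ('a \<Rightarrow> nat \<Rightarrow> bool)" where
  "state b 0 = ((\<lambda>x. x), fresh_label b 0)"
| "state b (Suc m) = (let \<rho> = fst (state b m); L = snd (state b m);
     \<rho>' = (\<lambda>x. target b m \<rho> L (\<rho> x)) in (\<rho>', \<lambda>x. relabel b m L (\<rho>' x)))"

definition root where "root b m = fst (state b m)"
definition label where "label b m = snd (state b m)"

lemma root_0 [simp]: "root b 0 x = x" and label_0 [simp]: "label b 0 x = fresh_label b 0 x"
  and root_Suc: "root b (Suc m) x = target b m (root b m) (label b m) (root b m x)"
  and label_Suc: "label b (Suc m) x = relabel b m (label b m) (root b (Suc m) x)"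
  by (simp_all add: root_def label_def Let_def)

lemma candidates_subset: "candidates b m \<rho> r \<subseteq> V"
  by (auto simp: candidates_def)

lemma pool_subset: "pool b m \<rho> L r \<subseteq> candidates b m \<rho> r"
  by (auto simp: pool_def close_candidates_def)

lemma pool_empty_iff: "pool b m \<rho> L r = {} \<longleftrightarrow> candidates b m \<rho> r = {}"
  by (auto simp: pool_def close_candidates_def)

lemma is_choice_in_candidates:
  "is_choice b m \<rho> L r y \<Longrightarrow> y \<in> candidates b m \<rho> r"
  using pool_subset[of b m \<rho> L r] by (auto simp: is_choice_def)

lemma is_choice_unique:
  assumes "r \<in> V" "is_choice b m \<rho> L r y" "is_choice b m \<rho> L r z"
  shows "y = z"
proof -
  have V: "y \<in> V" "z \<in> V"
    using assms(2,3)[THEN is_choice_in_candidates] candidates_subset[of b m \<rho> r] by auto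
  have "to_nat_on V (inv r \<otimes> y) = to_nat_on V (inv r \<otimes> z)"
    using assms unfolding is_choice_def by (metis order_antisym)
  then have "inv r \<otimes> y = inv r \<otimes> z"
    using V assms(1) inj_on_to_nat_on[OF countable_carrier] by (auto dest: inj_onD)
  then show ?thesis using V assms(1) by simp
qed

lemma is_choice_exists:
  assumes "candidates b m \<rho> r \<noteq> {}"
  shows "\<exists>y. is_choice b m \<rho> L r y"
proof -
  obtain y where "y \<in> pool b m \<rho> L r" using assms pool_empty_iff[of b m \<rho> L r] by auto
  then show ?thesis
    using ex_has_least_nat[of "\<lambda>y. y \<in> pool b m \<rho> L r" y "\<lambda>y. to_nat_on V (inv r \<otimes> y)"]
    unfolding is_choice_def by blast
qed

lemma target_eq_if_is_choice:
  assumes "r \<in> V" "\<not> is_head b m r" "is_choice b m \<rho> L r y"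
  shows "target b m \<rho> L r = \<rho> y"
proof -
  have "candidates b m \<rho> r \<noteq> {}"
    using is_choice_in_candidates[OF assms(3)] by auto
  moreover have "(SOME y. is_choice b m \<rho> L r y) = y"
    by (rule some_equality[where P = "is_choice b m \<rho> L r"])
      (fact assms(3), rule is_choice_unique[OF assms(1) _ assms(3)])
  ultimately show ?thesis using assms(2) by (simp add: target_def)
qed

lemma target_cases:
  assumes "r \<in> V"
  obtains "target b m \<rho> L r = r" "is_head b m r \<or> candidates b m \<rho> r = {}"
  | y where "\<not> is_head b m r" "is_choice b m \<rho> L r y" "y \<in> candidates b m \<rho> r"
      "target b m \<rho> L r = \<rho> y"
proof (cases "is_head b m r \<or> candidates b m \<rho> r = {}")
  case True
  then show ?thesis by (intro that(1)) (auto simp: target_def)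
next
  case False
  then obtain y where y: "is_choice b m \<rho> L r y" using is_choice_exists by blast
  then have "y \<in> candidates b m \<rho> r" by (rule is_choice_in_candidates)
  then show ?thesis using that(2)[of y] False y target_eq_if_is_choice[OF assms] by blast
qed

lemma target_head [simp]: "is_head b m r \<Longrightarrow> target b m \<rho> L r = r"
  by (simp add: target_def)

definition state_ok where
  "state_ok \<rho> L \<longleftrightarrow> (\<forall>x\<in>V. \<rho> x \<in> V \<and> \<rho> (\<rho> x) = \<rho> x \<and> L (\<rho> x) = L x \<and>
     (x, \<rho> x) \<in> (clust E \<rho>)\<^sup>* \<and> finite {y \<in> V. \<rho> y = x})"

text \<open>Targets of moves are fixed, so the new root map is idempotent; a merger uses an edge of
  the tree, so clusters stay connected; and a new cluster consists of an old one together with some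
  adjacent ones, finitely many because degrees are finite.\<close>

lemma state_ok: "state_ok (root b m) (label b m)"
proof (induction m)
  case 0
  have "finite {y \<in> V. y = x}" for x by (rule finite_subset[of _ "{x}"]) auto
  then show ?case by (simp add: state_ok_def)
next
  case (Suc m)
  define \<rho> where "\<rho> = root b m"
  define L where "L = label b m"
  define \<tau> where "\<tau> = target b m \<rho> L"
  define \<rho>' where "\<rho>' = root b (Suc m)"
  have \<rho>'_eq: "\<rho>' x = \<tau> (\<rho> x)" for x by (simp add: \<rho>'_def root_Suc \<tau>_def \<rho>_def L_def)
  have L'_eq: "label b (Suc m) x = relabel b m L (\<rho>' x)" for x
    by (simp add: label_Suc \<rho>'_def L_def)
  have \<rho>V: "\<rho> x \<in> V" and idem: "\<rho> (\<rho> x) = \<rho> x" and path: "(x, \<rho> x) \<in> (clust E \<rho>)\<^sup>*"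
    and fin: "finite {y \<in> V. \<rho> y = x}" if "x \<in> V" for x
    using Suc that by (auto simp: state_ok_def \<rho>_def L_def)
  have \<tau>: "\<tau> r \<in> V \<and> \<rho> (\<tau> r) = \<tau> r \<and> \<tau> (\<tau> r) = \<tau> r" if "r \<in> V" "\<rho> r = r" for r
    using that(1)
  proof (cases rule: target_cases[of r b m \<rho> L])
    case 1
    then show ?thesis using that by (simp add: \<tau>_def)
  next
    case (2 y)
    then have "y \<in> V" "is_head b m (\<rho> y)" by (auto simp: candidates_def)
    then show ?thesis using 2 \<rho>V idem by (simp add: \<tau>_def)
  qed
  have mono: "clust E \<rho> \<subseteq> clust E \<rho>'" by (auto simp: clust_def \<rho>'_eq)
  have path': "(x, \<rho>' x) \<in> (clust E \<rho>')\<^sup>*" if x: "x \<in> V" for x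
  proof -
    have 1: "(x, \<rho> x) \<in> (clust E \<rho>')\<^sup>*" using path[OF x] rtrancl_mono[OF mono] by blast
    show ?thesis using \<rho>V[OF x]
    proof (cases rule: target_cases[of "\<rho> x" b m \<rho> L])
      case 1
      then show ?thesis using \<open>(x, \<rho> x) \<in> _\<close> by (simp add: \<rho>'_eq \<tau>_def)
    next
      case (2 y)
      then obtain u where u: "u \<in> V" "\<rho> u = \<rho> x" "(u, y) \<in> E" "y \<in> V" "is_head b m (\<rho> y)"
        by (auto simp: candidates_def)
      have "(u, \<rho> x) \<in> (clust E \<rho>')\<^sup>*" using path[OF u(1)] u(2) rtrancl_mono[OF mono] by auto
      then have "(\<rho> x, u) \<in> (clust E \<rho>')\<^sup>*"
        using sym_rtrancl[OF sym_clust[OF sym_E]] by (blast dest: symD)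
      moreover have "(u, y) \<in> clust E \<rho>'"
        using u 2(4) by (simp add: clust_def \<rho>'_eq \<tau>_def)
      moreover have "(y, \<rho> y) \<in> (clust E \<rho>')\<^sup>*" using path[OF u(4)] rtrancl_mono[OF mono] by auto
      ultimately show ?thesis using 1 2(4)
        by (simp add: \<rho>'_eq \<tau>_def)
    qed
  qed
  have fin': "finite {y \<in> V. \<rho>' y = x}" if x: "x \<in> V" for x
  proof -
    \<comment> \<open>\<open>N\<close> is the set of neighbours of the old cluster with root
      \<open>x\<close>: any cluster that joins it touches it, hence contains a vertex of
      \<open>N\<close>.\<close>
    define N where "N = (\<Union>z\<in>{z \<in> V. \<rho> z = x}. {u. (z, u) \<in> E})"
    have "N \<subseteq> V" using E_subset by (auto simp: N_def)
    have "finite N" unfolding N_def using fin[OF x] degree_E by auto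
    have "{y \<in> V. \<rho>' y = x} \<subseteq> {y \<in> V. \<rho> y = x} \<union> (\<Union>u\<in>N. {y \<in> V. \<rho> y = \<rho> u})"
    proof
      fix y assume y: "y \<in> {y \<in> V. \<rho>' y = x}"
      then have "\<rho> y \<in> V" using \<rho>V by auto
      then show "y \<in> {y \<in> V. \<rho> y = x} \<union> (\<Union>u\<in>N. {y \<in> V. \<rho> y = \<rho> u})"
      proof (cases rule: target_cases[of "\<rho> y" b m \<rho> L])
        case 1
        then show ?thesis using y by (simp add: \<rho>'_eq \<tau>_def)
      next
        case (2 z)
        then obtain u where u: "u \<in> V" "\<rho> u = \<rho> y" "(u, z) \<in> E" "z \<in> V"
          by (auto simp: candidates_def)
        have "u \<in> N" using u y 2(4) sym_E by (auto simp: N_def \<rho>'_eq \<tau>_def dest: symD)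
        then show ?thesis using y u by force
      qed
    qed
    moreover have "finite (\<Union>u\<in>N. {y \<in> V. \<rho> y = \<rho> u})"
      using \<open>finite N\<close> \<open>N \<subseteq> V\<close> fin \<rho>V by auto
    ultimately show ?thesis using fin[OF x] finite_subset finite_Un by blast
  qed
  have "\<rho>' x \<in> V \<and> \<rho>' (\<rho>' x) = \<rho>' x" if "x \<in> V" for x
    using \<tau>[OF \<rho>V[OF that] idem[OF that]] by (simp add: \<rho>'_eq)
  then show ?case
    unfolding state_ok_def \<rho>'_def[symmetric] L'_eq using path' fin' by simp
qed

lemma root_closed: "x \<in> V \<Longrightarrow> root b m x \<in> V"
  and root_idem: "x \<in> V \<Longrightarrow> root b m (root b m x) = root b m x"
  and label_root: "x \<in> V \<Longrightarrow> label b m (root b m x) = label b m x"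
  and path_root: "x \<in> V \<Longrightarrow> (x, root b m x) \<in> (clust E (root b m))\<^sup>*"
  and finite_fibre: "x \<in> V \<Longrightarrow> finite {y \<in> V. root b m y = x}"
  using state_ok[of b m] by (auto simp: state_ok_def)

text \<open>This covers translations, the dependence of the state on earlier rounds only, and the
  flipping of label bits.\<close>

lemma state_transform:
  assumes g: "g \<in> V"
    and b': "\<And>x i k. x \<in> V \<Longrightarrow> i \<le> m \<Longrightarrow> b' (g \<otimes> x, i, k) = (b (x, i, k) \<noteq> label_mask s k)"
    and x: "x \<in> V"
  shows "root b' m (g \<otimes> x) = g \<otimes> root b m x \<and> label b' m (g \<otimes> x) = (\<lambda>i. label b m x i \<noteq> s i)"
  using b' x
proof (induction m arbitrary: x)
  case 0
  then show ?case by (simp add: fresh_label_def)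
next
  case (Suc m)
  define \<rho> where "\<rho> = root b m"
  define L where "L = label b m"
  define \<rho>' where "\<rho>' = root b' m"
  define L' where "L' = label b' m"
  have IH: "\<rho>' (g \<otimes> x) = g \<otimes> \<rho> x" "L' (g \<otimes> x) = (\<lambda>i. L x i \<noteq> s i)" if "x \<in> V" for x
    using Suc that by (auto simp: \<rho>_def L_def \<rho>'_def L'_def)
  have \<rho>V: "\<rho> x \<in> V" if "x \<in> V" for x using root_closed that by (simp add: \<rho>_def)
  note b' = Suc.prems(1)[of _ "Suc m", simplified]
  have head: "is_head b' m (g \<otimes> r) = is_head b m r" if "r \<in> V" for r
    using b'[OF that] by (simp add: is_head_def)
  have flag: "is_flagged b' m (g \<otimes> r) = is_flagged b m r" if "r \<in> V" for r
    using b'[OF that] by (simp add: is_flagged_def)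
  have relab: "relabel b' m L' (g \<otimes> r) = (\<lambda>i. relabel b m L r i \<noteq> s i)" if "r \<in> V" for r
    using b'[OF that] flag[OF that] IH(2)[OF that]
    by (simp add: relabel_def fresh_label_def)
  have cand: "g \<otimes> y \<in> candidates b' m \<rho>' (g \<otimes> r) \<longleftrightarrow> y \<in> candidates b m \<rho> r"
    if "r \<in> V" "y \<in> V" for r y
  proof -
    have "(\<exists>x\<in>V. \<rho>' x = g \<otimes> r \<and> (x, g \<otimes> y) \<in> E)
        \<longleftrightarrow> (\<exists>x\<in>V. \<rho>' (g \<otimes> x) = g \<otimes> r \<and> (g \<otimes> x, g \<otimes> y) \<in> E)"
      using g by (metis translate_cases m_closed)
    also have "\<dots> \<longleftrightarrow> (\<exists>x\<in>V. \<rho> x = r \<and> (x, y) \<in> E)"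
      using g that IH(1) \<rho>V E_translate by (intro bex_cong refl) simp
    finally show ?thesis
      using g that IH(1) \<rho>V head by (simp add: candidates_def)
  qed
  have close: "g \<otimes> y \<in> close_candidates b' m \<rho>' L' (g \<otimes> r) \<longleftrightarrow> y \<in> close_candidates b m \<rho> L r"
    if "r \<in> V" "y \<in> V" for r y
  proof -
    \<comment> \<open>Both labels are flipped by the same \<open>s\<close>, which cancels in the
      comparison. The choice looks at labels in no other way, so it is invariant under
      flips.\<close>
    have "agree (precision m) (relabel b' m L' (\<rho>' (g \<otimes> y))) (relabel b' m L' (g \<otimes> r))
      \<longleftrightarrow> agree (precision m) (relabel b m L (\<rho> y)) (relabel b m L r)"
      using that IH(1) \<rho>V relab by (auto simp: agree_def)
    then show ?thesis using cand[OF that] by (simp add: close_candidates_def)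
  qed
  have closeV: "close_candidates b m \<rho> L r \<subseteq> V" for b m \<rho> L r
    using candidates_subset[of b m \<rho> r] by (auto simp: close_candidates_def)
  have "close_candidates b' m \<rho>' L' (g \<otimes> r) = {} \<longleftrightarrow> close_candidates b m \<rho> L r = {}" if "r \<in> V" for r
    using close[OF that] closeV translate_cases[OF g] m_closed[OF g] by (metis ex_in_conv subsetD)
  then have pool: "g \<otimes> y \<in> pool b' m \<rho>' L' (g \<otimes> r) \<longleftrightarrow> y \<in> pool b m \<rho> L r"
    if "r \<in> V" "y \<in> V" for r y
    using that cand close by (simp add: pool_def)
  have poolV: "pool b m \<rho> L r \<subseteq> V" for b m \<rho> L r
    by (rule order_trans[OF pool_subset candidates_subset])
  have choice: "is_choice b' m \<rho>' L' (g \<otimes> r) (g \<otimes> y)" if "r \<in> V" and y: "is_choice b m \<rho> L r y" for r y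
    unfolding is_choice_def
  proof (intro conjI ballI)
    have yV: "y \<in> V" using is_choice_in_candidates[OF y] candidates_subset[of b m \<rho> r] by auto
    then show "g \<otimes> y \<in> pool b' m \<rho>' L' (g \<otimes> r)" using y pool that by (simp add: is_choice_def)
    fix z assume z: "z \<in> pool b' m \<rho>' L' (g \<otimes> r)"
    then have "z \<in> V" by (rule subsetD[OF poolV])
    then obtain z' where z': "z' \<in> V" "z = g \<otimes> z'" by (rule translate_cases[OF g])
    then have "z' \<in> pool b m \<rho> L r" using z pool that by simp
    then show "to_nat_on V (inv (g \<otimes> r) \<otimes> (g \<otimes> y)) \<le> to_nat_on V (inv (g \<otimes> r) \<otimes> z)"
      using y that z' yV g by (simp add: is_choice_def inv_mult_translate)
  qed
  have cand_empty: "candidates b' m \<rho>' (g \<otimes> r) = {} \<longleftrightarrow> candidates b m \<rho> r = {}" if "r \<in> V" for r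
    using cand[OF that] candidates_subset translate_cases[OF g] m_closed[OF g]
    by (metis ex_in_conv subsetD)
  have target: "target b' m \<rho>' L' (g \<otimes> r) = g \<otimes> target b m \<rho> L r" if r: "r \<in> V" for r
    using r
  proof (cases rule: target_cases[of r b m \<rho> L])
    case 1
    then show ?thesis using head[OF r] cand_empty[OF r] by (auto simp: target_def)
  next
    case (2 y)
    have "y \<in> V" by (rule subsetD[OF candidates_subset 2(3)])
    have "target b' m \<rho>' L' (g \<otimes> r) = \<rho>' (g \<otimes> y)"
      using target_eq_if_is_choice[OF m_closed[OF g r] _ choice[OF r 2(2)]] head[OF r] 2(1) by simp
    then show ?thesis using IH(1)[OF \<open>y \<in> V\<close>] 2(4) by simp
  qed
  have root: "root b' (Suc m) (g \<otimes> x) = g \<otimes> root b (Suc m) x" if "x \<in> V" for x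
    using target[OF \<rho>V[OF that]] IH(1)[OF that]
    by (simp add: root_Suc \<rho>_def L_def \<rho>'_def L'_def)
  have "label b' (Suc m) (g \<otimes> x) = (\<lambda>i. label b (Suc m) x i \<noteq> s i)" if "x \<in> V" for x
    using relab[OF root_closed[OF that]] root[OF that] by (simp add: label_Suc L_def L'_def)
  then show ?case using root Suc.prems(2) by simp
qed

end

lemma pred_bex_countable:
  assumes "countable X" "\<And>i. i \<in> X \<Longrightarrow> Measurable.pred M (P i)"
  shows "Measurable.pred M (\<lambda>x. \<exists>i\<in>X. P i x)"
  unfolding pred_def
  by (rule sets.sets_Collect_countable_Ex'[OF _ assms(1)]) (rule assms(2)[unfolded pred_def])

lemma pred_ball_countable:
  assumes "countable X" "\<And>i. i \<in> X \<Longrightarrow> Measurable.pred M (P i)"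
  shows "Measurable.pred M (\<lambda>x. \<forall>i\<in>X. P i x)"
  unfolding pred_def
  by (rule sets.sets_Collect_countable_All'[OF _ assms(1)]) (rule assms(2)[unfolded pred_def])

lemma pred_all_less:
  assumes "\<And>i. i < n \<Longrightarrow> Measurable.pred M (P i)"
  shows "Measurable.pred M (\<lambda>x. \<forall>i<(n::nat). P i x)"
proof -
  have eq: "(\<forall>i<n. P i x) \<longleftrightarrow> (\<forall>i\<in>{..<n}. P i x)" for x by auto
  show ?thesis unfolding eq
  proof (rule pred_ball_countable)
    fix i assume "i \<in> {..<n}"
    then have "i < n" by simp
    then show "Measurable.pred M (P i)" by (rule assms)
  qed simp
qed

lemma pred_const: "Measurable.pred M (\<lambda>x. c)"
  by (rule measurable_const) simp

lemmas pred_not = pred_intros_logic(2)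
lemmas pred_conj = pred_intros_logic(3)
lemmas pred_imp = pred_intros_logic(4)
lemmas pred_disj = pred_intros_logic(5)
lemmas pred_iff = pred_intros_logic(6)

context tree_group
begin

section \<open>Clusters as finite subtrees\<close>

definition cluster where
  "cluster b m x = {y \<in> V. root b m y = root b m x}"

lemma finite_cluster: "x \<in> V \<Longrightarrow> finite (cluster b m x)"
  unfolding cluster_def by (intro finite_fibre root_closed)

lemma mem_cluster_self: "x \<in> V \<Longrightarrow> x \<in> cluster b m x"
  by (simp add: cluster_def)

lemma clust_path_in_cluster:
  assumes "(x, y) \<in> (clust E (root b m))\<^sup>*" "x \<in> cluster b m v"
  shows "y \<in> cluster b m v \<and> (x, y) \<in> (E \<inter> cluster b m v \<times> cluster b m v)\<^sup>*"
  using assms(1)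
proof (induction rule: rtrancl_induct)
  case base
  then show ?case using assms(2) by simp
next
  case (step y z)
  then have "z \<in> cluster b m v" "(y, z) \<in> E"
    using E_subset by (auto simp: clust_def cluster_def)
  then show ?case using step.IH by (meson IntI SigmaI rtrancl.rtrancl_into_rtrancl)
qed

lemma connected_in_cluster: "connected_in E (cluster b m v)"
  unfolding connected_in_def
proof (intro ballI)
  fix x y assume xy: "x \<in> cluster b m v" "y \<in> cluster b m v"
  then have "x \<in> V" "y \<in> V" "root b m x = root b m y" by (auto simp: cluster_def)
  then have "(x, root b m y) \<in> (clust E (root b m))\<^sup>*" "(root b m y, y) \<in> (clust E (root b m))\<^sup>*"
    using path_root[of x b m] path_root[of y b m] sym_rtrancl[OF sym_clust[OF sym_E, of "root b m"]]
    by (auto dest: symD)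
  then have "(x, y) \<in> (clust E (root b m))\<^sup>*" by (rule rtrancl_trans)
  then show "(x, y) \<in> (E \<inter> cluster b m v \<times> cluster b m v)\<^sup>*"
    using clust_path_in_cluster xy(1) by blast
qed

definition neighbour_roots where
  "neighbour_roots b m x = root b m ` outer_boundary E (cluster b m x)"

text \<open>Distinct clusters are disjoint and connected, so at most one edge joins them. Different
  boundary vertices thus lie in different clusters, and the boundary count for subtrees becomes a
  count of adjacent clusters.\<close>

lemma neighbour_roots:
  assumes x: "x \<in> V"
  shows "finite (neighbour_roots b m x)"
    and "card (neighbour_roots b m x) = card (cluster b m x) + 2"
    and "root b m x \<notin> neighbour_roots b m x"
    and "neighbour_roots b m x \<subseteq> V"
proof -
  let ?C = "cluster b m x"
  have bV: "outer_boundary E ?C \<subseteq> V" using E_subset by (auto simp: outer_boundary_def)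
  have fc: "finite (outer_boundary E ?C) \<and> card (outer_boundary E ?C) = card ?C + 2"
    using degree_E finite_cluster[OF x] mem_cluster_self[OF x] connected_in_cluster
    by (intro card_outer_boundary[OF sym_E irrefl_E acyclic_E]) (auto simp: cluster_def)
  have "inj_on (root b m) (outer_boundary E ?C)"
  proof (rule inj_onI)
    fix y1 y2 assume y: "y1 \<in> outer_boundary E ?C" "y2 \<in> outer_boundary E ?C"
      and eq: "root b m y1 = root b m y2"
    then obtain u1 u2 where u: "u1 \<in> ?C" "(u1, y1) \<in> E" "u2 \<in> ?C" "(u2, y2) \<in> E"
      and nC: "y1 \<notin> ?C" by (auto simp: outer_boundary_def)
    have yV: "y1 \<in> V" "y2 \<in> V" using y bV by auto
    have y2: "y2 \<in> cluster b m y1" "y1 \<in> cluster b m y1" using yV eq by (auto simp: cluster_def)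
    have disj: "?C \<inter> cluster b m y1 = {}" using nC yV by (auto simp: cluster_def)
    show "y1 = y2"
      by (rule acyclic_unique_crossing_edge(2)[OF sym_E acyclic_E disj u(1,3) _ y2(2,1) _ u(2,4)])
        (use connected_in_cluster u y2 in \<open>auto simp: connected_in_def\<close>)
  qed
  then show "card (neighbour_roots b m x) = card ?C + 2" "finite (neighbour_roots b m x)"
    using fc by (auto simp: neighbour_roots_def card_image)
  show "root b m x \<notin> neighbour_roots b m x"
    using bV by (auto simp: neighbour_roots_def outer_boundary_def cluster_def)
  show "neighbour_roots b m x \<subseteq> V" using bV root_closed by (auto simp: neighbour_roots_def)
qed

lemma mem_candidates_if_neighbour_root:
  assumes "x \<in> V" "d \<in> neighbour_roots b m x" "is_head b m d"
  obtains y where "y \<in> candidates b m (root b m) (root b m x)" "root b m y = d"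
proof -
  obtain y where y: "y \<in> outer_boundary E (cluster b m x)" "d = root b m y"
    using assms(2) by (auto simp: neighbour_roots_def)
  then obtain u where u: "u \<in> cluster b m x" "(u, y) \<in> E" "y \<notin> cluster b m x"
    by (auto simp: outer_boundary_def)
  then have "y \<in> V" using E_subset by auto
  then have "y \<in> candidates b m (root b m) (root b m x)"
    using u y assms(3) by (auto simp: candidates_def cluster_def)
  then show ?thesis using y that by blast
qed

section \<open>Measurability of the process\<close>

abbreviation coin_field :: "('a \<times> nat \<times> nat \<Rightarrow> bool) measure" where
  "coin_field \<equiv> bits (V \<times> UNIV)"

lemma pred_bit: "r \<in> V \<Longrightarrow> Measurable.pred coin_field (\<lambda>b. b (r, i, k))"
  by (rule measurable_bits_component[of "(r, i, k)" "V \<times> UNIV"]) auto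

text \<open>Trades the choice operator for quantifiers over the countable vertex set, a form in
  which measurability can be read off.\<close>

lemma target_eq_iff:
  assumes "r \<in> V"
  shows "target b m \<rho> L r = z \<longleftrightarrow>
    (is_head b m r \<or> \<not> (\<exists>y\<in>V. y \<in> candidates b m \<rho> r)) \<and> r = z \<or>
    (\<not> is_head b m r \<and> (\<exists>y\<in>V. is_choice b m \<rho> L r y \<and> \<rho> y = z))"
  using assms
proof (cases rule: target_cases[of r b m \<rho> L])
  case 1
  then show ?thesis using is_choice_in_candidates[of b m \<rho> L r] candidates_subset[of b m \<rho> r] by auto
next
  case (2 y)
  have "y \<in> V" by (rule subsetD[OF candidates_subset 2(3)])
  have "(\<exists>y\<in>V. is_choice b m \<rho> L r y \<and> \<rho> y = z) \<longleftrightarrow> \<rho> y = z"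
    using is_choice_unique[OF assms 2(2)] 2(2) \<open>y \<in> V\<close> by metis
  moreover have "\<exists>y\<in>V. y \<in> candidates b m \<rho> r" using 2(3) \<open>y \<in> V\<close> by (rule bexI)
  ultimately show ?thesis using 2(1,4) by simp
qed

text \<open>Every event of a round is a countable combination of earlier ones: a random vertex such
  as \<open>root b m y\<close> is handled by quantifying over its values in \<open>V\<close>. Roots
  and labels are treated together because each new root depends on labels and each new label on
  roots.\<close>

lemma pred_state:
  assumes "x \<in> V"
  shows "(\<forall>z\<in>V. Measurable.pred coin_field (\<lambda>b. root b m x = z)) \<and>
    (\<forall>i. Measurable.pred coin_field (\<lambda>b. label b m x i))"
  using assms
proof (induction m arbitrary: x)
  case 0
  then show ?case by (auto simp: fresh_label_def intro!: pred_const pred_bit)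
next
  case (Suc m)
  have root: "Measurable.pred coin_field (\<lambda>b. root b m x = z)" if "x \<in> V" "z \<in> V" for x z
    using Suc.IH that by blast
  have label: "Measurable.pred coin_field (\<lambda>b. label b m x i)" if "x \<in> V" for x i
    using Suc.IH that by blast
  note bex = pred_bex_countable[OF countable_carrier]
  have head: "Measurable.pred coin_field (\<lambda>b. is_head b m r)" if "r \<in> V" for r
    unfolding is_head_def using that by (rule pred_bit)
  have flag: "Measurable.pred coin_field (\<lambda>b. is_flagged b m r)" if "r \<in> V" for r
    unfolding is_flagged_def by (rule pred_all_less[OF pred_bit[OF that]])
  have relab: "Measurable.pred coin_field (\<lambda>b. relabel b m (label b m) r i)" if "r \<in> V" for r i
  proof -
    have eq: "relabel b m (label b m) r i \<longleftrightarrow>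
      (is_flagged b m r \<and> b (r, Suc m, 2 * i + 2)) \<or> (\<not> is_flagged b m r \<and> label b m r i)" for b
      by (auto simp: relabel_def fresh_label_def)
    show ?thesis unfolding eq 
      by (rule pred_disj[OF pred_conj[OF flag[OF that] pred_bit[OF that]]
          pred_conj[OF pred_not[OF flag[OF that]] label[OF that]]])
  qed
  have relab_root: "Measurable.pred coin_field (\<lambda>b. relabel b m (label b m) (root b m y) i)"
    if "y \<in> V" for y i
  proof -
    have eq: "relabel b m (label b m) (root b m y) i \<longleftrightarrow>
      (\<exists>t\<in>V. root b m y = t \<and> relabel b m (label b m) t i)" for b
      using root_closed[OF that] by auto
    show ?thesis unfolding eq 
      by (rule bex) (rule pred_conj[OF root[OF that] relab])
  qed
  have cand: "Measurable.pred coin_field (\<lambda>b. y \<in> candidates b m (root b m) r)"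
    if "r \<in> V" "y \<in> V" for r y
  proof -
    have eq: "y \<in> candidates b m (root b m) r \<longleftrightarrow> \<not> root b m y = r \<and>
      (\<exists>t\<in>V. root b m y = t \<and> is_head b m t) \<and> (\<exists>x\<in>V. root b m x = r \<and> (x, y) \<in> E)" for b
      using that root_closed[OF that(2)] by (auto simp: candidates_def)
    show ?thesis unfolding eq 
      by (rule pred_conj[OF pred_not[OF root[OF that(2,1)]]
            pred_conj[OF bex[OF pred_conj[OF root[OF that(2)] head]]
              bex[OF pred_conj[OF root[OF _ that(1)] pred_const]]]])
  qed
  have close: "Measurable.pred coin_field (\<lambda>b. y \<in> close_candidates b m (root b m) (label b m) r)"
    if "r \<in> V" "y \<in> V" for r y
  proof -
    have eq: "y \<in> close_candidates b m (root b m) (label b m) r \<longleftrightarrow> y \<in> candidates b m (root b m) r \<and>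
      (\<forall>i<precision m. relabel b m (label b m) (root b m y) i = relabel b m (label b m) r i)" for b
      by (simp add: close_candidates_def agree_def)
    show ?thesis unfolding eq
      by (rule pred_conj[OF cand[OF that] pred_all_less[OF pred_iff[OF relab_root[OF that(2)] relab[OF that(1)]]]])
  qed
  have pool: "Measurable.pred coin_field (\<lambda>b. y \<in> pool b m (root b m) (label b m) r)"
    if "r \<in> V" "y \<in> V" for r y
  proof -
    have eq: "y \<in> pool b m (root b m) (label b m) r \<longleftrightarrow>
      y \<in> close_candidates b m (root b m) (label b m) r \<or>
      (y \<in> candidates b m (root b m) r \<and>
        \<not> (\<exists>z\<in>V. z \<in> close_candidates b m (root b m) (label b m) r))" for b
    proof -
      have "close_candidates b m (root b m) (label b m) r \<subseteq> V"
        using candidates_subset[of b m "root b m" r] by (auto simp: close_candidates_def)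
      then have "close_candidates b m (root b m) (label b m) r = {} \<longleftrightarrow>
          \<not> (\<exists>z\<in>V. z \<in> close_candidates b m (root b m) (label b m) r)" by auto
      then show ?thesis by (simp add: pool_def close_candidates_def) blast
    qed
    show ?thesis unfolding eq 
      by (rule pred_disj[OF close[OF that] pred_conj[OF cand[OF that]
          pred_not[OF bex[OF close[OF that(1)]]]]])
  qed
  have choice: "Measurable.pred coin_field (\<lambda>b. is_choice b m (root b m) (label b m) r y)"
    if "r \<in> V" "y \<in> V" for r y
  proof -
    have eq: "is_choice b m (root b m) (label b m) r y \<longleftrightarrow> y \<in> pool b m (root b m) (label b m) r \<and>
      (\<forall>z\<in>V. z \<in> pool b m (root b m) (label b m) r \<longrightarrow>
        to_nat_on V (inv r \<otimes> y) \<le> to_nat_on V (inv r \<otimes> z))" for b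
    proof -
      have "pool b m (root b m) (label b m) r \<subseteq> V"
        by (rule order_trans[OF pool_subset candidates_subset])
      then show ?thesis by (auto simp: is_choice_def)
    qed
    show ?thesis unfolding eq 
      by (rule pred_conj[OF pool[OF that] pred_ball_countable[OF countable_carrier
          pred_imp[OF pool[OF that(1)] pred_const]]])
  qed
  have target: "Measurable.pred coin_field (\<lambda>b. target b m (root b m) (label b m) r = z)"
    if "r \<in> V" "z \<in> V" for r z
    unfolding target_eq_iff[OF that(1)]
    by (rule pred_disj[OF
          pred_conj[OF pred_disj[OF head[OF that(1)] pred_not[OF bex[OF cand[OF that(1)]]]] pred_const]
          pred_conj[OF pred_not[OF head[OF that(1)]] bex[OF pred_conj[OF choice[OF that(1)] root[OF _ that(2)]]]]])
  have root_Suc': "Measurable.pred coin_field (\<lambda>b. root b (Suc m) x = z)" if "x \<in> V" "z \<in> V" for x z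
  proof -
    have eq: "root b (Suc m) x = z \<longleftrightarrow>
      (\<exists>r\<in>V. root b m x = r \<and> target b m (root b m) (label b m) r = z)" for b
      using root_closed[OF that(1)] by (auto simp: root_Suc)
    show ?thesis unfolding eq 
      by (rule bex) (rule pred_conj[OF root[OF that(1)] target[OF _ that(2)]])
  qed
  have "Measurable.pred coin_field (\<lambda>b. label b (Suc m) x i)" if "x \<in> V" for x i
  proof -
    have eq: "label b (Suc m) x i \<longleftrightarrow>
      (\<exists>r\<in>V. root b (Suc m) x = r \<and> relabel b m (label b m) r i)" for b
      using root_closed[OF that] by (auto simp: label_Suc)
    show ?thesis unfolding eq 
      by (rule bex) (rule pred_conj[OF root_Suc'[OF that] relab])
  qed
  then show ?case using root_Suc' Suc.prems by blast
qed

lemma pred_root: "x \<in> V \<Longrightarrow> z \<in> V \<Longrightarrow> Measurable.pred coin_field (\<lambda>b. root b m x = z)"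
  and pred_label: "x \<in> V \<Longrightarrow> Measurable.pred coin_field (\<lambda>b. label b m x i)"
  using pred_state by blast+

lemma pred_same_root:
  assumes "x \<in> V" "y \<in> V"
  shows "Measurable.pred coin_field (\<lambda>b. root b m x = root b m y)"
proof -
  have eq: "root b m x = root b m y \<longleftrightarrow> (\<exists>z\<in>V. root b m x = z \<and> root b m y = z)" for b
    using root_closed[OF assms(1)] by auto
  show ?thesis unfolding eq
    by (rule pred_bex_countable[OF countable_carrier])
      (rule pred_conj[OF pred_root[OF assms(1)] pred_root[OF assms(2)]])
qed

lemma pred_card_cluster:
  assumes x: "x \<in> V"
  shows "Measurable.pred coin_field (\<lambda>b. P (card (cluster b m x)))"
proof -
  have ge: "Measurable.pred coin_field (\<lambda>b. n \<le> card (cluster b m x))" for n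
  proof -
    \<comment> \<open>A countable set has only countably many finite subsets, so the size of a
      random cluster is reached by countable operations.\<close>
    have eq: "n \<le> card (cluster b m x) \<longleftrightarrow>
      (\<exists>F\<in>{F. finite F \<and> F \<subseteq> V}. card F = n \<and> (\<forall>y\<in>V. y \<in> F \<longrightarrow> root b m y = root b m x))" for b
    proof
      assume "n \<le> card (cluster b m x)"
      then obtain F where "F \<subseteq> cluster b m x" "card F = n" "finite F"
        by (rule obtain_subset_with_card_n)
      then show "\<exists>F\<in>{F. finite F \<and> F \<subseteq> V}. card F = n \<and> (\<forall>y\<in>V. y \<in> F \<longrightarrow> root b m y = root b m x)"
        by (intro bexI[of _ F]) (auto simp: cluster_def)
    next
      assume "\<exists>F\<in>{F. finite F \<and> F \<subseteq> V}. card F = n \<and> (\<forall>y\<in>V. y \<in> F \<longrightarrow> root b m y = root b m x)"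
      then obtain F where "card F = n" "F \<subseteq> cluster b m x" by (auto simp: cluster_def)
      then show "n \<le> card (cluster b m x)" using card_mono[OF finite_cluster[OF x]] by blast
    qed
    show ?thesis unfolding eq
      by (rule pred_bex_countable[OF countable_Collect_finite_subset[OF countable_carrier]],
          rule pred_conj[OF pred_const pred_ball_countable[OF countable_carrier]],
          rule pred_imp[OF pred_const pred_same_root[OF _ x]])
  qed
  have eq: "P c \<longleftrightarrow> (\<exists>n\<in>UNIV. P n \<and> n \<le> c \<and> \<not> Suc n \<le> c)" for c
  proof
    assume "\<exists>n\<in>UNIV. P n \<and> n \<le> c \<and> \<not> Suc n \<le> c"
    then obtain n where "P n" "n \<le> c" "\<not> Suc n \<le> c" by blast
    moreover from this have "n = c" by linarith
    ultimately show "P c" by simp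
  qed (intro bexI[of _ c]; simp)
  show ?thesis
    by (subst eq, rule pred_bex_countable[OF countableI_type],
        rule pred_conj[OF pred_const pred_conj[OF ge pred_not[OF ge]]])
qed

end

section \<open>Estimates for one round\<close>

text \<open>Distinct vertices read disjoint coins, so the failures are independent. The exponent is
  \<open>Suc n\<close> because positions 0 to \<open>n\<close> are prescribed.\<close>

lemma prob_no_pattern:
  assumes "finite D" "D \<subseteq> V"
  shows "measure (bits (V \<times> UNIV)) {b \<in> space (bits (V \<times> UNIV)).
      \<forall>d\<in>D. \<not> (\<forall>k\<le>n. b (d, i, k) = w k)} = (1 - (1 / 2) ^ Suc n) ^ card D"
    (is "measure ?B _ = _")
  using assms
proof (induction D rule: finite_induct)
  case empty
  show ?case using prob_space.prob_space[OF prob_space_bits, of "V \<times> UNIV"] by simp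
next
  case (insert d D)
  interpret prob_space ?B by (rule prob_space_bits)
  define Q where "Q c b \<longleftrightarrow> (\<forall>k\<in>{..n}. b (c, i, k) = w k)" for c and b :: "'a \<times> 'b \<times> nat \<Rightarrow> bool"
  have Q: "Measurable.pred ?B (Q c)" if "c \<in> V" for c
    unfolding Q_def
    by (rule pred_ball_countable, simp, rule pred_eq_const, rule measurable_bits_component)
      (use that in simp)
  have cyl: "prob {b \<in> space ?B. Q d b} = (1 / 2) ^ Suc n"
  proof -
    have "{b \<in> space ?B. Q d b} = {b \<in> space ?B. \<forall>j\<in>(\<lambda>k. (d, i, k)) ` {..n}. b j = (w \<circ> snd \<circ> snd) j}"
      by (auto simp: Q_def)
    also have "prob \<dots> = (1 / 2) ^ card ((\<lambda>k. (d, i, k)) ` {..n})"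
      by (rule measure_bits_cylinder) (use insert.prems in auto)
    also have "card ((\<lambda>k. (d, i, k)) ` {..n}) = Suc n"
      by (subst card_image) (auto simp: inj_on_def)
    finally show ?thesis .
  qed
  have all: "Measurable.pred ?B (\<lambda>b. \<forall>c\<in>D. \<not> Q c b)"
    by (rule pred_ball_countable[OF countable_finite[OF insert.hyps(1)]], rule pred_not, rule Q)
      (use insert.prems in auto)
  have "prob {b \<in> space ?B. \<not> Q d b \<and> (\<forall>c\<in>D. \<not> Q c b)}
      = prob {b \<in> space ?B. \<not> Q d b} * prob {b \<in> space ?B. \<forall>c\<in>D. \<not> Q c b}"
  proof (rule prob_conj_bits_disjoint[where A = "{d} \<times> UNIV"])
    show "Measurable.pred ?B (\<lambda>b. \<not> Q d b)" by (rule pred_not, rule Q) (use insert.prems in auto)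
    show "(\<not> Q d (mix (V \<times> UNIV) ({d} \<times> UNIV) b b')) = (\<not> Q d b)" for b b'
      using insert.prems by (simp add: Q_def mix_def)
    have "Q c (mix (V \<times> UNIV) ({d} \<times> UNIV) b b') = Q c b'" if "c \<in> D" for b b' c
      using insert.prems insert.hyps(2) that by (auto simp: Q_def mix_def)
    then show "(\<forall>c\<in>D. \<not> Q c (mix (V \<times> UNIV) ({d} \<times> UNIV) b b')) = (\<forall>c\<in>D. \<not> Q c b')" for b b'
      by simp
  qed (fact all)
  also have "prob {b \<in> space ?B. \<not> Q d b} = 1 - (1 / 2) ^ Suc n"
    using prob_neg[OF predE[OF Q[of d]]] cyl insert.prems by simp
  finally show ?case using insert by (simp add: Q_def atMost_def)
qed

context tree_group
begin

abbreviation pr where "pr Q \<equiv> measure coin_field {b \<in> space coin_field. Q b}"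

section \<open>Conditioning on earlier rounds\<close>

text \<open>The state after \<open>m\<close> rounds reads round indices up to \<open>m\<close>, and
  the step to \<open>Suc m\<close> reads the index \<open>Suc m\<close>. Redrawing all coins outside
  \<open>past m\<close> therefore keeps the state and makes the next round independent of
  it.\<close>

definition past where "past m = (V \<times> {..m} \<times> UNIV :: ('a \<times> nat \<times> nat) set)"

lemma state_mix_past:
  assumes "x \<in> V"
  shows "root (mix (V \<times> UNIV) (past m) b b') m x = root b m x"
    and "label (mix (V \<times> UNIV) (past m) b b') m x = label b m x"
proof -
  have "mix (V \<times> UNIV) (past m) b b' (\<one> \<otimes> x, i, k) = (b (x, i, k) \<noteq> label_mask (\<lambda>_. False) k)"
    if "x \<in> V" "i \<le> m" for x i k
    using that by (simp add: mix_def past_def label_mask_def)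
  from state_transform[OF one_closed this assms]
  show "root (mix (V \<times> UNIV) (past m) b b') m x = root b m x"
    "label (mix (V \<times> UNIV) (past m) b b') m x = label b m x"
    using assms root_closed[OF assms, of b m] by simp_all
qed

lemma cluster_mix_past:
  assumes "x \<in> V"
  shows "cluster (mix (V \<times> UNIV) (past m) b b') m x = cluster b m x"
    and "neighbour_roots (mix (V \<times> UNIV) (past m) b b') m x = neighbour_roots b m x"
proof -
  show c: "cluster (mix (V \<times> UNIV) (past m) b b') m x = cluster b m x"
    using state_mix_past(1)[of _ m b b'] assms by (auto simp: cluster_def)
  have "outer_boundary E (cluster b m x) \<subseteq> V" using E_subset by (auto simp: outer_boundary_def)
  then show "neighbour_roots (mix (V \<times> UNIV) (past m) b b') m x = neighbour_roots b m x"
    unfolding neighbour_roots_def c using state_mix_past(1)[of _ m b b']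
    by (intro image_cong refl) auto
qed

lemma mix_past_Suc: "x \<in> V \<Longrightarrow> mix (V \<times> UNIV) (past m) b b' (x, Suc m, k) = b' (x, Suc m, k)"
  by (simp add: mix_def past_def)

section \<open>Translation invariance\<close>

definition translate where
  "translate g b = (\<lambda>i\<in>V \<times> UNIV. b (inv g \<otimes> fst i, snd i) \<noteq> False)"

lemma
  assumes "g \<in> V"
  shows measurable_translate: "translate g \<in> coin_field \<rightarrow>\<^sub>M coin_field"
    and distr_translate: "distr coin_field coin_field (translate g) = coin_field"
proof -
  have inj: "inj_on (\<lambda>i. (inv g \<otimes> fst i, snd i)) (V \<times> UNIV)"
    using assms by (auto simp: inj_on_def)
  have sub: "(\<lambda>i. (inv g \<otimes> fst i, snd i)) ` (V \<times> UNIV) \<subseteq> V \<times> UNIV" using assms by auto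
  show "translate g \<in> coin_field \<rightarrow>\<^sub>M coin_field" "distr coin_field coin_field (translate g) = coin_field"
    using distr_bits_transform[OF inj sub, of "\<lambda>_. False"] unfolding translate_def[abs_def] by blast+
qed

lemma pr_translate:
  assumes "g \<in> V" "Measurable.pred coin_field Q"
  shows "pr (\<lambda>b. Q (translate g b)) = pr Q"
proof -
  have "pr Q = measure (distr coin_field coin_field (translate g)) {b \<in> space coin_field. Q b}"
    by (simp only: distr_translate[OF assms(1)])
  also have "\<dots> = measure coin_field (translate g -` {b \<in> space coin_field. Q b} \<inter> space coin_field)"
    by (rule measure_distr[OF measurable_translate[OF assms(1)] predE[OF assms(2)]])
  also have "translate g -` {b \<in> space coin_field. Q b} \<inter> space coin_field
      = {b \<in> space coin_field. Q (translate g b)}"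
    using measurable_space[OF measurable_translate[OF assms(1)]] by auto
  finally show ?thesis by simp
qed

lemma state_translate:
  assumes "g \<in> V" "x \<in> V"
  shows "root (translate g b) m (g \<otimes> x) = g \<otimes> root b m x"
    and "label (translate g b) m (g \<otimes> x) = label b m x"
proof -
  have "translate g b (g \<otimes> x, i, k) = (b (x, i, k) \<noteq> label_mask (\<lambda>_. False) k)" if "x \<in> V" for x i k
    using that assms(1) by (simp add: translate_def label_mask_def flip: m_assoc)
  from state_transform[OF assms(1) this assms(2)]
  show "root (translate g b) m (g \<otimes> x) = g \<otimes> root b m x"
    "label (translate g b) m (g \<otimes> x) = label b m x" by simp_all
qed

lemma card_cluster_translate:
  assumes "g \<in> V" "x \<in> V"
  shows "card (cluster (translate g b) m (g \<otimes> x)) = card (cluster b m x)"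
proof -
  have "cluster (translate g b) m (g \<otimes> x) = (\<otimes>) g ` cluster b m x"
  proof (intro equalityI subsetI)
    fix y assume y: "y \<in> cluster (translate g b) m (g \<otimes> x)"
    then have "y \<in> V" by (simp add: cluster_def)
    then obtain y' where "y' \<in> V" "y = g \<otimes> y'" by (rule translate_cases[OF assms(1)])
    then show "y \<in> (\<otimes>) g ` cluster b m x"
      using y assms root_closed by (auto simp: cluster_def state_translate)
  qed (use assms in \<open>auto simp: cluster_def state_translate\<close>)
  moreover have "inj_on ((\<otimes>) g) (cluster b m x)"
    using assms(1) by (auto simp: inj_on_def cluster_def)
  ultimately show ?thesis by (simp add: card_image)
qed

section \<open>Survival of roots and growth of clusters\<close>

text \<open>A moving cluster adopts a root that exists already and belongs to a different cluster,
  so new roots never arise and a root that moves is lost.\<close>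

lemma root_Suc_fixed:
  assumes x: "x \<in> V" and fixed: "root b (Suc m) x = x"
  shows "root b m x = x" "is_head b m x \<or> candidates b m (root b m) x = {}"
proof -
  have "root b m x = x \<and> (is_head b m x \<or> candidates b m (root b m) x = {})"
    using root_closed[OF x, of b m]
  proof (cases rule: target_cases[of "root b m x" b m "root b m" "label b m"])
    case 1
    then show ?thesis using fixed by (simp add: root_Suc)
  next
    case (2 y)
    then have y: "y \<in> V" "root b m y \<noteq> root b m x" by (auto simp: candidates_def)
    have "root b m y = x" using 2(4) fixed by (simp add: root_Suc)
    then show ?thesis using y root_idem[OF y(1), of b m] by simp
  qed
  then show "root b m x = x" "is_head b m x \<or> candidates b m (root b m) x = {}" by auto
qed

text \<open>Given the past, fix any adjacent cluster, with root \<open>d\<close>. If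
  \<open>x\<close> tosses tail and \<open>d\<close> tosses head, then \<open>x\<close> has a
  candidate and ceases to be a root; this has conditional probability 1/4.\<close>

lemma pr_root_Suc:
  assumes x: "x \<in> V"
  shows "pr (\<lambda>b. root b (Suc m) x = x) \<le> 3 / 4 * pr (\<lambda>b. root b m x = x)"
proof (rule prob_le_by_mix[where A = "past m"])
  fix b assume root: "root b m x = x"
  have "neighbour_roots b m x \<noteq> {}" using neighbour_roots(2)[OF x, of b m] by auto
  then obtain d where d: "d \<in> neighbour_roots b m x" by blast
  have dV: "d \<in> V" "d \<noteq> x" using neighbour_roots(3,4)[OF x, of b m] d root by auto
  define J where "J = {(x, Suc m, 0 :: nat), (d, Suc m, 0)}"
  define w where "w i \<longleftrightarrow> i \<noteq> (x, Suc m, 0 :: nat)" for i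
  interpret prob_space coin_field by (rule prob_space_bits)
  have J: "finite J" "J \<subseteq> V \<times> UNIV" "card J = 2" using x dV by (auto simp: J_def)
  have "{b' \<in> space coin_field. root (mix (V \<times> UNIV) (past m) b b') (Suc m) x = x}
    \<subseteq> {b' \<in> space coin_field. \<not> (\<forall>j\<in>J. b' j = w j)}"
  proof safe
    fix b' assume b': "root (mix (V \<times> UNIV) (past m) b b') (Suc m) x = x" "\<forall>j\<in>J. b' j = w j"
    let ?b = "mix (V \<times> UNIV) (past m) b b'"
    have "\<not> is_head ?b m x" "is_head ?b m d"
      using b'(2) dV x by (auto simp: is_head_def mix_past_Suc J_def w_def)
    moreover have "d \<in> neighbour_roots ?b m x" using d by (simp add: cluster_mix_past(2)[OF x])
    ultimately obtain y where "y \<in> candidates ?b m (root ?b m) (root ?b m x)"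
      using mem_candidates_if_neighbour_root[OF x] by metis
    then show False using root_Suc_fixed[OF x b'(1)] \<open>\<not> is_head ?b m x\<close> by auto
  qed
  then have "pr (\<lambda>b'. root (mix (V \<times> UNIV) (past m) b b') (Suc m) x = x)
      \<le> pr (\<lambda>b'. \<not> (\<forall>j\<in>J. b' j = w j))"
    by (rule finite_measure_mono[OF _ sets.sets_Collect_neg[OF sets_bits_cylinder[OF J(1,2)]]])
  also have "\<dots> = 1 - (1 / 2) ^ card J"
    using prob_neg[OF sets_bits_cylinder[OF J(1,2), of w]] measure_bits_cylinder[OF J(1,2), of w] by simp
  also have "\<dots> = 3 / 4" using J(3) by (simp add: power2_eq_square)
  finally show "pr (\<lambda>b'. root (mix (V \<times> UNIV) (past m) b b') (Suc m) x = x) \<le> 3 / 4" .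
next
  fix b b' assume "root (mix (V \<times> UNIV) (past m) b b') (Suc m) x = x"
  from root_Suc_fixed(1)[OF x this] show "root b m x = x" by (simp add: state_mix_past[OF x])
next
  show "Measurable.pred coin_field (\<lambda>b. root b (Suc m) x = x)"
    "Measurable.pred coin_field (\<lambda>b. root b m x = x)" by (rule pred_root[OF x x])+
qed simp

lemma pr_root: "x \<in> V \<Longrightarrow> pr (\<lambda>b. root b m x = x) \<le> (3 / 4) ^ m"
proof (induction m)
  case 0
  interpret prob_space coin_field by (rule prob_space_bits)
  show ?case by simp
next
  case (Suc m)
  then show ?case using pr_root_Suc[of x m] by simp
qed


text \<open>Mass transport: every vertex of a cluster with fewer than \<open>K\<close> vertices sends unit mass to the root.\<close>

lemma pr_small_cluster_one:
  assumes K: "0 \<le> K"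
  shows "pr (\<lambda>b. real (card (cluster b m \<one>)) < K) \<le> K * pr (\<lambda>b. root b m \<one> = \<one>)"
proof -
  interpret prob_space coin_field by (rule prob_space_bits)
  define Q where "Q x b \<longleftrightarrow> real (card (cluster b m x)) < K" for x b
  have Q: "Measurable.pred coin_field (Q x)" if "x \<in> V" for x
    unfolding Q_def[abs_def] by (rule pred_card_cluster[OF that])
  have QS: "Measurable.pred coin_field (\<lambda>b. root b m x = y \<and> Q x b)" if "x \<in> V" "y \<in> V" for x y
    by (rule pred_conj[OF pred_root[OF that] Q[OF that(1)]])
  have sets1: "{b \<in> space coin_field. root b m \<one> = g \<and> Q \<one> b} \<in> sets coin_field" if "g \<in> V" for g
    by (rule predE[OF QS[OF one_closed that]])
  have sets2: "{b \<in> space coin_field. root b m (inv g) = \<one> \<and> Q (inv g) b} \<in> sets coin_field"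
    if "g \<in> V" for g
    by (rule predE[OF QS]) (use that in auto)
  have "{b \<in> space coin_field. Q \<one> b}
      = (\<Union>g\<in>V. {b \<in> space coin_field. root b m \<one> = g \<and> Q \<one> b})"
    using root_closed[OF one_closed] by auto
  then have "emeasure coin_field {b \<in> space coin_field. Q \<one> b}
      = (\<integral>\<^sup>+g. emeasure coin_field {b \<in> space coin_field. root b m \<one> = g \<and> Q \<one> b} \<partial>count_space V)"
    using sets1 countable_carrier
    by (simp only:, intro emeasure_UN_countable) (auto simp: disjoint_family_on_def)
  \<comment> \<open>Translation by \<open>g\<close> moves the pair of \<open>inv g\<close> and
    \<open>\<one>\<close> to the pair of \<open>\<one>\<close> and \<open>g\<close>: mass sent from
    the identity is exchanged for mass received there.\<close>
  also have "\<dots> = (\<integral>\<^sup>+g. emeasure coin_field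
      {b \<in> space coin_field. root b m (inv g) = \<one> \<and> Q (inv g) b} \<partial>count_space V)"
  proof (rule nn_integral_cong)
    fix g assume "g \<in> space (count_space V)"
    then have g: "g \<in> V" by simp
    have "root (translate g b) m \<one> = g \<longleftrightarrow> root b m (inv g) = \<one>"
      "Q \<one> (translate g b) \<longleftrightarrow> Q (inv g) b" for b
      using state_translate(1)[OF g inv_closed[OF g], of b m] card_cluster_translate[OF g inv_closed[OF g], of b m]
        g root_closed[OF inv_closed[OF g], of b m] r_cancel_one[OF g]
      by (auto simp: Q_def)
    then show "emeasure coin_field {b \<in> space coin_field. root b m \<one> = g \<and> Q \<one> b}
        = emeasure coin_field {b \<in> space coin_field. root b m (inv g) = \<one> \<and> Q (inv g) b}"
      using pr_translate[OF g QS[OF one_closed g]] by (simp add: emeasure_eq_measure)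
  qed
  also have "\<dots> = (\<integral>\<^sup>+g. \<integral>\<^sup>+b. indicator {b \<in> space coin_field. root b m (inv g) = \<one> \<and> Q (inv g) b} b
      \<partial>coin_field \<partial>count_space V)"
    using sets2 by (intro nn_integral_cong nn_integral_indicator[symmetric]) simp
  also have "\<dots> = (\<integral>\<^sup>+b. \<integral>\<^sup>+g. indicator {b \<in> space coin_field. root b m (inv g) = \<one> \<and> Q (inv g) b} b
      \<partial>count_space V \<partial>coin_field)"
    using sets2
    by (intro nn_integral_count_space_nn_integral[symmetric] countable_carrier borel_measurable_indicator)
  also have "\<dots> \<le> (\<integral>\<^sup>+b. ennreal K * indicator {b \<in> space coin_field. root b m \<one> = \<one>} b \<partial>coin_field)"
  proof (rule nn_integral_mono)
    fix b assume b: "b \<in> space coin_field"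
    \<comment> \<open>\<open>T\<close> consists of the inverses of the vertices that send mass to
      the identity. If there are any, then the identity is a root and they all lie in its cluster,
      which has fewer than \<open>K\<close> vertices.\<close>
    define T where "T = {g \<in> V. root b m (inv g) = \<one> \<and> Q (inv g) b}"
    have "(\<integral>\<^sup>+g. indicator {b \<in> space coin_field. root b m (inv g) = \<one> \<and> Q (inv g) b} b \<partial>count_space V)
        = (\<integral>\<^sup>+g. indicator T g \<partial>count_space V)"
      using b by (intro nn_integral_cong) (auto simp: T_def indicator_def)
    also have "\<dots> = emeasure (count_space V) T"
      by (rule nn_integral_indicator) (auto simp: T_def)
    also have "\<dots> \<le> ennreal K * indicator {b \<in> space coin_field. root b m \<one> = \<one>} b"
    proof (cases "T = {}")
      case False
      then obtain g where g: "g \<in> V" "root b m (inv g) = \<one>" "Q (inv g) b" by (auto simp: T_def)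
      have one: "root b m \<one> = \<one>" using root_idem[OF inv_closed[OF g(1)], of b m] g(2) by simp
      have "cluster b m (inv g) = cluster b m \<one>" using g(2) one by (simp add: cluster_def)
      then have small: "real (card (cluster b m \<one>)) < K" using g(3) by (simp add: Q_def)
      have "T \<subseteq> m_inv G ` cluster b m \<one>"
        unfolding T_def cluster_def using one by (force intro: rev_image_eqI[of "inv _"])
      then have "finite T" "card T \<le> card (cluster b m \<one>)"
        using finite_cluster[OF one_closed, of b m] finite_subset surj_card_le by blast+
      then have "emeasure (count_space V) T \<le> ennreal K"
        using small by (subst emeasure_count_space_finite)
          (auto simp: T_def ennreal_of_nat_eq_real_of_nat intro!: ennreal_leI)
      then show ?thesis using b one by simp
    qed simp
    finally show "(\<integral>\<^sup>+g. indicator {b \<in> space coin_field. root b m (inv g) = \<one> \<and> Q (inv g) b} b \<partial>count_space V)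
        \<le> ennreal K * indicator {b \<in> space coin_field. root b m \<one> = \<one>} b" .
  qed
  also have "\<dots> = ennreal K * emeasure coin_field {b \<in> space coin_field. root b m \<one> = \<one>}"
    by (rule nn_integral_cmult_indicator[OF predE[OF pred_root[OF one_closed one_closed]]])
  finally have "ennreal (pr (Q \<one>)) \<le> ennreal (K * pr (\<lambda>b. root b m \<one> = \<one>))"
    using K by (simp add: emeasure_eq_measure ennreal_mult)
  then show ?thesis using K by (simp add: Q_def ennreal_le_iff)
qed

lemma pr_small_cluster:
  assumes K: "0 \<le> K" and x: "x \<in> V"
  shows "pr (\<lambda>b. real (card (cluster b m x)) < K) \<le> K * (3 / 4) ^ m"
proof -
  have "pr (\<lambda>b. real (card (cluster b m x)) < K)
      = pr (\<lambda>b. real (card (cluster (translate x b) m x)) < K)"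
    by (rule pr_translate[OF x pred_card_cluster[OF x], symmetric])
  also have "\<dots> = pr (\<lambda>b. real (card (cluster b m \<one>)) < K)"
    using card_cluster_translate[OF x one_closed] x by simp
  also have "\<dots> \<le> K * pr (\<lambda>b. root b m \<one> = \<one>)" by (rule pr_small_cluster_one[OF K])
  also have "\<dots> \<le> K * (3 / 4) ^ m" by (intro mult_left_mono pr_root K one_closed)
  finally show ?thesis .
qed

section \<open>Stability of the labels\<close>

definition settled where
  "settled b m x \<longleftrightarrow> agree (precision m) (label b (Suc m) x) (label b m x)"

text \<open>An unflagged root looks for heads close to its current label. The neighbour
  \<open>d\<close> makes the set of close candidates nonempty, so the chosen head is close too, even
  if it is not \<open>d\<close>; a cluster that stays keeps its label.\<close>

lemma settled_if_good_neighbour: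
  assumes x: "x \<in> V" and nf: "\<not> is_flagged b m (root b m x)"
    and d: "d \<in> neighbour_roots b m x" "is_head b m d"
      "agree (precision m) (relabel b m (label b m) d) (label b m x)"
  shows "settled b m x"
proof -
  let ?r = "root b m x" and ?L = "label b m"
  have r: "relabel b m ?L ?r = ?L x" using nf label_root[OF x] by (simp add: relabel_def)
  show ?thesis using root_closed[OF x, of b m]
  proof (cases rule: target_cases[of ?r b m "root b m" ?L])
    case 1
    then show ?thesis using r by (simp add: settled_def label_Suc root_Suc agree_def)
  next
    case (2 y)
    obtain z where "z \<in> candidates b m (root b m) ?r" "root b m z = d"
      by (rule mem_candidates_if_neighbour_root[OF x d(1,2)])
    then have "z \<in> close_candidates b m (root b m) ?L ?r"
      using d(3) by (simp add: close_candidates_def r)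
    then have "pool b m (root b m) ?L ?r = close_candidates b m (root b m) ?L ?r"
      by (auto simp: pool_def)
    then have "y \<in> close_candidates b m (root b m) ?L ?r"
      using 2(2) by (simp add: is_choice_def)
    then show ?thesis
      using 2(4) by (simp add: settled_def label_Suc root_Suc close_candidates_def r)
  qed
qed

text \<open>The coins of an ideal neighbour: head at position 0, replacement at odd positions, and a
  fresh label spelling \<open>w\<close> at positive even ones, where \<open>k div 2 - 1\<close>
  inverts \<open>2 * i + 2\<close>.\<close>

definition good_pattern :: "(nat \<Rightarrow> bool) \<Rightarrow> nat \<Rightarrow> bool" where
  "good_pattern w k \<longleftrightarrow> (k \<noteq> 0 \<and> even k \<longrightarrow> w (k div 2 - 1))"

lemma good_pattern_simps [simp]:
  "good_pattern w 0" "good_pattern w (Suc (2 * i))" "good_pattern w (Suc (Suc (2 * i))) = w i"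
  by (simp_all add: good_pattern_def)

lemma pred_settled:
  assumes "x \<in> V"
  shows "Measurable.pred coin_field (\<lambda>b. settled b m x)"
  unfolding settled_def agree_def
  by (rule pred_all_less[OF pred_iff[OF pred_label[OF assms] pred_label[OF assms]]])

text \<open>Given the past, the label to be matched and the neighbouring roots are fixed. Failure
  requires that the cluster's own root is flagged, the first term, or that none of at least
  \<open>K\<close> neighbours shows the ideal pattern on \<open>2 * precision m + 1\<close> new
  coins, the second. The old labels of neighbours never enter, so their correlation with
  \<open>w\<close> is harmless.\<close>

lemma pr_unsettled_large_cluster:
  assumes x: "x \<in> V"
  shows "pr (\<lambda>b. \<not> settled b m x \<and> K \<le> card (cluster b m x))
    \<le> (1 / 2) ^ precision m + (1 - (1 / 2) ^ Suc (2 * precision m)) ^ K"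
proof -
  interpret prob_space coin_field by (rule prob_space_bits)
  let ?p = "precision m"
  let ?c = "(1 / 2) ^ ?p + (1 - (1 / 2) ^ Suc (2 * ?p)) ^ K :: real"
  have le1: "(1 / 2 :: real) ^ Suc (2 * ?p) \<le> 1" by (rule power_le_one) simp_all
  have c: "0 \<le> ?c" by (intro add_nonneg_nonneg zero_le_power) (use le1 in simp_all)
  have "pr (\<lambda>b. \<not> settled b m x \<and> K \<le> card (cluster b m x)) \<le> ?c * pr (\<lambda>b. K \<le> card (cluster b m x))"
  proof (rule prob_le_by_mix[where A = "past m"])
    show "Measurable.pred coin_field (\<lambda>b. \<not> settled b m x \<and> K \<le> card (cluster b m x))"
      by (rule pred_conj[OF pred_not[OF pred_settled[OF x]] pred_card_cluster[OF x]])
    show "Measurable.pred coin_field (\<lambda>b. K \<le> card (cluster b m x))" by (rule pred_card_cluster[OF x])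
    show "0 \<le> ?c" by (rule c)
    fix b b'
    show "K \<le> card (cluster b m x)"
      if "\<not> settled (mix (V \<times> UNIV) (past m) b b') m x \<and>
        K \<le> card (cluster (mix (V \<times> UNIV) (past m) b b') m x)"
      using that by (simp add: cluster_mix_past[OF x])
  next
    fix b assume large: "K \<le> card (cluster b m x)"
    define r where "r = root b m x"
    define w where "w = label b m x"
    define D where "D = neighbour_roots b m x"
    have rV: "r \<in> V" using root_closed[OF x] by (simp add: r_def)
    have D: "finite D" "D \<subseteq> V" "K \<le> card D"
      using neighbour_roots[OF x, of b m] large by (auto simp: D_def)
    define J where "J = (\<lambda>i. (r, Suc m, 2 * i + 1)) ` {..<?p}"
    have J: "finite J" "J \<subseteq> V \<times> UNIV" "card J = ?p"
      using rV by (auto simp: J_def card_image inj_on_def)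
    define F where "F = {b' \<in> space coin_field. \<forall>j\<in>J. b' j = True}"
    define N where "N = {b' \<in> space coin_field. \<forall>d\<in>D. \<not> (\<forall>k\<le>2 * ?p. b' (d, Suc m, k) = good_pattern w k)}"
    have F: "F \<in> sets coin_field" unfolding F_def by (rule sets_bits_cylinder[OF J(1,2)])
    have N: "N \<in> sets coin_field"
    proof -
      have eq: "(\<forall>k\<le>n. P k) \<longleftrightarrow> (\<forall>k\<in>{..n}. P k)" for n :: nat and P by auto
      show ?thesis unfolding N_def eq
        by (rule predE, rule pred_ball_countable[OF countable_finite[OF D(1)]], rule pred_not,
            rule pred_ball_countable[OF countable_finite[OF finite_atMost]], rule pred_eq_const, rule pred_bit)
          (use D(2) in auto)
    qed
    have sub: "{b' \<in> space coin_field. \<not> settled (mix (V \<times> UNIV) (past m) b b') m x \<and>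
        K \<le> card (cluster (mix (V \<times> UNIV) (past m) b b') m x)} \<subseteq> F \<union> N"
    proof (intro subsetI, rule ccontr)
      fix b' assume b': "b' \<in> {b' \<in> space coin_field. \<not> settled (mix (V \<times> UNIV) (past m) b b') m x \<and>
        K \<le> card (cluster (mix (V \<times> UNIV) (past m) b b') m x)}" and "b' \<notin> F \<union> N"
      let ?b = "mix (V \<times> UNIV) (past m) b b'"
      obtain d where d: "d \<in> D" "\<And>k. k \<le> 2 * ?p \<Longrightarrow> b' (d, Suc m, k) = good_pattern w k"
        using b' \<open>b' \<notin> F \<union> N\<close> by (auto simp: N_def)
      have dV: "d \<in> V" using d(1) D(2) by auto
      have bits: "?b (d, Suc m, k) = good_pattern w k" if "k \<le> 2 * ?p" for k
        using d(2)[OF that] mix_past_Suc[OF dV] by simp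
      have "\<not> is_flagged ?b m r"
        using b' \<open>b' \<notin> F \<union> N\<close> mix_past_Suc[OF rV] by (auto simp: F_def J_def is_flagged_def)
      moreover have "is_head ?b m d" using bits[of 0] by (simp add: is_head_def)
      moreover have "is_flagged ?b m d" using bits by (simp add: is_flagged_def)
      moreover have "agree ?p (fresh_label ?b (Suc m) d) w" using bits by (simp add: agree_def fresh_label_def)
      ultimately have "settled ?b m x"
        using d(1) by (intro settled_if_good_neighbour[OF x, of _ _ d])
          (simp_all add: state_mix_past[OF x] cluster_mix_past[OF x] r_def D_def w_def relabel_def)
      then show False using b' by simp
    qed
    have "pr (\<lambda>b'. \<not> settled (mix (V \<times> UNIV) (past m) b b') m x \<and>
        K \<le> card (cluster (mix (V \<times> UNIV) (past m) b b') m x)) \<le> prob (F \<union> N)"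
      by (rule finite_measure_mono[OF sub sets.Un[OF F N]])
    also have "\<dots> \<le> prob F + prob N" by (rule measure_Un_le[OF F N])
    also have "prob F = (1 / 2) ^ ?p"
      using measure_bits_cylinder[OF J(1,2), of "\<lambda>_. True"] J(3) unfolding F_def by simp
    also have "prob N = (1 - (1 / 2) ^ Suc (2 * ?p)) ^ card D"
      unfolding N_def by (rule prob_no_pattern[OF D(1,2)])
    also have "\<dots> \<le> (1 - (1 / 2) ^ Suc (2 * ?p)) ^ K"
      by (rule power_decreasing[OF D(3)]) (use le1 in simp_all)
    finally show "pr (\<lambda>b'. \<not> settled (mix (V \<times> UNIV) (past m) b b') m x \<and>
        K \<le> card (cluster (mix (V \<times> UNIV) (past m) b b') m x)) \<le> ?c" by simp
  qed
  also have "\<dots> \<le> ?c * 1" by (intro mult_left_mono c prob_le_1)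
  finally show ?thesis by simp
qed

end

section \<open>The limit labeling\<close>

text \<open>Rests on 4 \<le> (9/8)^20, one of the two conditions behind the divisor 20. The base 9/8
  stays below the growth rate 5/4 of clusters and leaves a factor 10/9 per round.\<close>

lemma four_power_precision_le: "4 ^ precision m \<le> (9 / 8 :: real) ^ m"
proof -
  have "(4 :: real) ^ precision m \<le> ((9 / 8) ^ 20) ^ precision m"
    by (rule power_mono) (simp_all add: power_divide)
  also have "\<dots> = (9 / 8) ^ (20 * precision m)" by (rule power_mult[symmetric])
  also have "\<dots> \<le> (9 / 8) ^ m" by (rule power_increasing) (simp_all add: precision_def)
  finally show ?thesis .
qed

text \<open>The other condition on the divisor 20: (97/100)^20 still exceeds 1/2. As the division
  rounds down, one more power is taken, whence the \<open>Suc\<close> and the constant 2.\<close>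

lemma half_power_precision_le: "(1 / 2) ^ precision m \<le> 2 * (97 / 100 :: real) ^ m"
proof -
  have "(1 / 2 :: real) ^ Suc (precision m) \<le> ((97 / 100) ^ 20) ^ Suc (precision m)"
    by (rule power_mono) (simp_all add: power_divide)
  also have "\<dots> = (97 / 100) ^ (20 * Suc (precision m))" by (rule power_mult[symmetric])
  also have "\<dots> \<le> (97 / 100) ^ m" by (rule power_decreasing) (simp_all add: precision_def)
  finally show ?thesis by simp
qed

text \<open>A modest substitute for the exponential bound, from Bernoulli's inequality and (1 - q)(1
  + q) \<le> 1. It suffices because the product of \<open>n\<close> and \<open>q\<close> will grow
  geometrically.\<close>

lemma power_one_minus_le_inverse:
  fixes q :: real
  assumes "0 \<le> q" "q \<le> 1"
  shows "(1 - q) ^ n * (real n * q) \<le> 1"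
proof -
  have "(1 - q) ^ n * (real n * q) \<le> (1 - q) ^ n * (1 + q) ^ n"
    using Bernoulli_inequality[of q n] assms by (intro mult_left_mono) auto
  also have "\<dots> = (1 - q * q) ^ n" by (simp add: algebra_simps flip: power_mult_distrib)
  also have "\<dots> \<le> 1"
    using assms mult_le_one[of q q] by (intro power_le_one) auto
  finally show ?thesis .
qed

context tree_group
begin

text \<open>The terms stand for a small cluster, with 15/16 the product of 5/4 and 3/4, for a flag
  at the cluster's own root, and for the lack of a suitable neighbour.\<close>

lemma pr_bad:
  assumes x: "x \<in> V"
  shows "pr (\<lambda>b. \<not> (settled b m x \<and> (5 / 4) ^ m \<le> real (card (cluster b m x))))
    \<le> (15 / 16) ^ m + 2 * (97 / 100) ^ m + 2 * (9 / 10) ^ m"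
proof -
  interpret prob_space coin_field by (rule prob_space_bits)
  define K where "K = nat \<lceil>(5 / 4 :: real) ^ m\<rceil>"
  define q :: real where "q = (1 / 2) ^ Suc (2 * precision m)"
  have K: "(5 / 4) ^ m \<le> real K" unfolding K_def by (rule real_nat_ceiling_ge)
  have q: "0 \<le> q" "q = 1 / (2 * 4 ^ precision m)"
    by (simp_all add: q_def power_mult power_divide)
  have q1: "q \<le> 1" unfolding q_def by (rule power_le_one) simp_all
  let ?S = "{b \<in> space coin_field. real (card (cluster b m x)) < (5 / 4) ^ m}"
  let ?U = "{b \<in> space coin_field. \<not> settled b m x \<and> K \<le> card (cluster b m x)}"
  have S: "?S \<in> sets coin_field" by (rule predE[OF pred_card_cluster[OF x]])
  have U: "?U \<in> sets coin_field"
    by (rule predE[OF pred_conj[OF pred_not[OF pred_settled[OF x]] pred_card_cluster[OF x]]])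
  have "{b \<in> space coin_field. \<not> (settled b m x \<and> (5 / 4) ^ m \<le> real (card (cluster b m x)))} \<subseteq> ?S \<union> ?U"
    by (auto simp: K_def nat_ceiling_le_eq)
  then have "pr (\<lambda>b. \<not> (settled b m x \<and> (5 / 4) ^ m \<le> real (card (cluster b m x)))) \<le> prob (?S \<union> ?U)"
    by (rule finite_measure_mono) (rule sets.Un[OF S U])
  also have "\<dots> \<le> prob ?S + prob ?U" by (rule measure_Un_le[OF S U])
  also have "prob ?S \<le> (5 / 4) ^ m * (3 / 4) ^ m" by (rule pr_small_cluster[OF _ x]) simp
  also have "\<dots> = (15 / 16) ^ m" by (simp flip: power_mult_distrib)
  also have "prob ?U \<le> (1 / 2) ^ precision m + (1 - q) ^ K"
    unfolding q_def by (rule pr_unsettled_large_cluster[OF x])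
  also have "(1 / 2) ^ precision m \<le> 2 * (97 / 100 :: real) ^ m" by (rule half_power_precision_le)
  also have "(1 - q) ^ K \<le> 2 * (9 / 10) ^ m"
  proof -
    \<comment> \<open>The mean number \<open>K * q\<close> of suitable neighbours among
      \<open>K\<close> grows at least at the rate 10/9, the quotient of 5/4 and 9/8.\<close>
    have "(10 / 9) ^ m / 2 = (5 / 4) ^ m * (1 / (2 * (9 / 8 :: real) ^ m))"
      by (simp add: field_simps flip: power_mult_distrib)
    also have "\<dots> \<le> real K * q"
      unfolding q(2) using four_power_precision_le[of m] K
      by (intro mult_mono divide_left_mono) auto
    finally have "(1 - q) ^ K * ((10 / 9) ^ m / 2) \<le> (1 - q) ^ K * (real K * q)"
      using q1 by (intro mult_left_mono) auto
    also have "\<dots> \<le> 1" by (rule power_one_minus_le_inverse[OF q(1) q1])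
    finally have "(1 - q) ^ K * ((10 / 9) ^ m / 2) * (2 * (9 / 10) ^ m) \<le> 1 * (2 * (9 / 10) ^ m)"
      by (intro mult_right_mono) auto
    moreover have "(10 / 9 :: real) ^ m / 2 * (2 * (9 / 10) ^ m) = 1"
      by (simp flip: power_mult_distrib)
    ultimately show ?thesis by (simp only: mult.assoc mult_1 mult_1_right)
  qed
  finally show ?thesis by simp
qed

lemma AE_eventually_good:
  assumes x: "x \<in> V"
  shows "AE b in coin_field. \<forall>\<^sub>F m in sequentially.
    settled b m x \<and> (5 / 4) ^ m \<le> real (card (cluster b m x))"
proof -
  interpret prob_space coin_field by (rule prob_space_bits)
  define B where "B m = {b \<in> space coin_field.
    \<not> (settled b m x \<and> (5 / 4) ^ m \<le> real (card (cluster b m x)))}" for m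
  have "B m \<in> sets coin_field" for m
    unfolding B_def by (rule predE[OF pred_not[OF pred_conj[OF pred_settled[OF x] pred_card_cluster[OF x]]]])
  moreover have "summable (\<lambda>m. prob (B m))"
  proof (rule summable_comparison_test')
    show "summable (\<lambda>m. (15 / 16) ^ m + 2 * (97 / 100) ^ m + 2 * (9 / 10 :: real) ^ m)"
      by (intro summable_add summable_mult summable_geometric) simp_all
    show "norm (prob (B m)) \<le> (15 / 16) ^ m + 2 * (97 / 100) ^ m + 2 * (9 / 10) ^ m" if "0 \<le> m" for m
      using pr_bad[OF x, of m] by (simp add: B_def)
  qed
  moreover have "emeasure coin_field (B m) < \<infinity>" for m by (simp add: emeasure_eq_measure)
  ultimately have "AE b in coin_field. \<forall>\<^sub>F m in sequentially. b \<in> space coin_field - B m"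
    by (intro borel_cantelli_AE1) blast+
  then show ?thesis
    by (rule AE_mp) (auto simp: B_def intro!: AE_I2 elim!: eventually_mono)
qed

text \<open>An oscillating bit is read as false, so the limit is defined for every \<open>b\<close>.
  Equivariance then holds at every sample point, as the notion of an FIID labeling demands, and not
  just almost surely.\<close>

definition limit_label where
  "limit_label b x k \<longleftrightarrow> (\<forall>\<^sub>F m in sequentially. label b m x k)"

lemma label_stabilizes:
  assumes "\<forall>\<^sub>F m in sequentially. settled b m x \<and> (5 / 4) ^ m \<le> real (card (cluster b m x))"
  shows "\<forall>\<^sub>F m in sequentially. label b m x k = limit_label b x k"
proof -
  obtain N where N: "\<And>m. N \<le> m \<Longrightarrow> settled b m x"
    using assms by (auto simp: eventually_sequentially)
  \<comment> \<open>From \<open>20 * Suc k\<close> on, \<open>precision m\<close> exceeds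
    \<open>k\<close>, so every settled round preserves bit \<open>k\<close>.\<close>
  define M where "M = max N (20 * Suc k)"
  have "label b m x k = label b M x k" if "M \<le> m" for m
    using that
  proof (induction m rule: dec_induct)
    case (step m)
    have "20 * Suc k \<le> m" "N \<le> m" using step.hyps by (auto simp: M_def)
    then have "Suc k \<le> m div 20" using div_le_mono[of "20 * Suc k" m 20] by simp
    then have "k < precision m" by (simp add: precision_def)
    then have "label b (Suc m) x k = label b m x k"
      using N[OF \<open>N \<le> m\<close>] by (simp add: settled_def agree_def)
    then show ?case using step.IH by simp
  qed simp
  then have ev: "\<forall>\<^sub>F m in sequentially. label b m x k = label b M x k"
    by (rule eventually_sequentiallyI)
  have "limit_label b x k \<longleftrightarrow> (\<forall>\<^sub>F m :: nat in sequentially. label b M x k)"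
    unfolding limit_label_def by (rule eventually_cong[OF ev]) simp
  then show ?thesis using ev by simp
qed

section \<open>Flip symmetry and the law of the limit\<close>

definition flip_labels where
  "flip_labels s b = (\<lambda>i\<in>V \<times> UNIV. b (id i) \<noteq> label_mask s (snd (snd i)))"

lemma measurable_flip_labels: "flip_labels s \<in> coin_field \<rightarrow>\<^sub>M coin_field"
  and distr_flip_labels: "distr coin_field coin_field (flip_labels s) = coin_field"
  unfolding flip_labels_def[abs_def] by (rule distr_bits_transform; simp)+

lemma label_flip_labels:
  assumes "x \<in> V"
  shows "label (flip_labels s b) m x = (\<lambda>k. label b m x k \<noteq> s k)"
proof -
  have "flip_labels s b (\<one> \<otimes> x, i, k) = (b (x, i, k) \<noteq> label_mask s k)" if "x \<in> V" for x i k
    using that by (simp add: flip_labels_def)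
  from state_transform[OF one_closed this assms] show ?thesis using assms by simp
qed

text \<open>Convergence matters here: for an oscillating bit neither the bit nor its negation is
  eventually true, and the flip would be lost in the limit. The symmetry is therefore available only
  almost surely.\<close>

lemma limit_label_flip_labels:
  assumes x: "x \<in> V"
    and good: "\<forall>\<^sub>F m in sequentially. settled b m x \<and> (5 / 4) ^ m \<le> real (card (cluster b m x))"
  shows "limit_label (flip_labels s b) x k \<longleftrightarrow> limit_label b x k \<noteq> s k"
proof -
  have "(\<forall>\<^sub>F m in sequentially. label b m x k \<noteq> s k)
      \<longleftrightarrow> (\<forall>\<^sub>F m :: nat in sequentially. limit_label b x k \<noteq> s k)"
    by (rule eventually_cong[OF label_stabilizes[OF good, of k]]) simp
  then show ?thesis
    by (simp add: limit_label_def[of "flip_labels s b"] label_flip_labels[OF x])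
qed

lemma measurable_limit_label:
  assumes x: "x \<in> V"
  shows "(\<lambda>b. limit_label b x) \<in> coin_field \<rightarrow>\<^sub>M bits UNIV"
proof (rule measurable_bitsI)
  fix k
  have eq: "limit_label b x k \<longleftrightarrow> (\<exists>N\<in>UNIV. \<forall>n\<in>UNIV. N \<le> n \<longrightarrow> label b n x k)" for b
    by (simp add: limit_label_def eventually_sequentially)
  show "Measurable.pred coin_field (\<lambda>b. limit_label b x k)"
    unfolding eq
    by (rule pred_bex_countable[OF countableI_type], rule pred_ball_countable[OF countableI_type],
        rule pred_imp[OF pred_const pred_label[OF x]])
qed simp

lemma distr_limit_label:
  assumes x: "x \<in> V"
  shows "distr coin_field (bits UNIV) (\<lambda>b. limit_label b x) = bits UNIV"
proof (rule distr_eq_bits_if_xor_invariant[OF measurable_limit_label[OF x] prob_space_bits])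
  fix s
  let ?X = "\<lambda>b. limit_label b x"
  have "distr coin_field (bits UNIV) (\<lambda>b. \<lambda>k\<in>UNIV. limit_label b x k \<noteq> s k)
      = distr coin_field (bits UNIV) (?X \<circ> flip_labels s)"
  proof (rule distr_cong_AE[OF refl])
    show "AE b in coin_field. (\<lambda>k\<in>UNIV. limit_label b x k \<noteq> s k) = (?X \<circ> flip_labels s) b"
      using AE_eventually_good[OF x]
    proof (rule AE_mp, intro AE_I2 impI)
      fix b assume "\<forall>\<^sub>F m in sequentially. settled b m x \<and> (5 / 4) ^ m \<le> real (card (cluster b m x))"
      from limit_label_flip_labels[OF x this, of s]
      show "(\<lambda>k\<in>UNIV. limit_label b x k \<noteq> s k) = (?X \<circ> flip_labels s) b" by (simp add: fun_eq_iff)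
    qed
    show "?X \<circ> flip_labels s \<in> coin_field \<rightarrow>\<^sub>M bits UNIV"
      by (rule measurable_comp[OF measurable_flip_labels measurable_limit_label[OF x]])
    show "(\<lambda>b. \<lambda>k\<in>UNIV. limit_label b x k \<noteq> s k) \<in> coin_field \<rightarrow>\<^sub>M bits UNIV"
    proof (rule measurable_bitsI)
      fix k :: nat
      have "Measurable.pred coin_field (\<lambda>b. limit_label b x k)"
        using measurable_compose[OF measurable_limit_label[OF x] measurable_bits_component[OF UNIV_I]] .
      from pred_not[OF pred_iff[OF this pred_const]]
      show "Measurable.pred coin_field (\<lambda>b. (\<lambda>k\<in>UNIV. limit_label b x k \<noteq> s k) k)"
        by (simp only: restrict_UNIV)
    qed simp
  qed simp
  also have "\<dots> = distr (distr coin_field coin_field (flip_labels s)) (bits UNIV) ?X"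
    by (rule distr_distr[OF measurable_limit_label[OF x] measurable_flip_labels, symmetric])
  also have "\<dots> = distr coin_field (bits UNIV) ?X" by (simp only: distr_flip_labels)
  finally show "distr coin_field (bits UNIV) (\<lambda>b. \<lambda>k\<in>UNIV. limit_label b x k \<noteq> s k)
      = distr coin_field (bits UNIV) ?X" .
qed

section \<open>Infinite clusters and equivariance\<close>

text \<open>Vertices with a common root keep a common root in all later rounds, so their labels
  agree from round \<open>m\<close> on. Their limits agree for every \<open>b\<close>, whether or
  not the labels converge.\<close>

lemma clust_root_subset: "clust E (root b m) \<subseteq> clust E (limit_label b)"
proof
  fix e assume e: "e \<in> clust E (root b m)"
  obtain u v where uv: "e = (u, v)" by (cases e)
  have E: "(u, v) \<in> E" and eq: "root b m u = root b m v" using e uv by (auto simp: clust_def)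
  have V: "u \<in> V" "v \<in> V" using E E_subset by auto
  have "label b n u = label b n v" if "m \<le> n" for n
  proof -
    have "root b n u = root b n v" using that
      by (induction n rule: dec_induct) (simp_all add: eq root_Suc)
    then show ?thesis using label_root[OF V(1), of b n] label_root[OF V(2), of b n] by simp
  qed
  then have ev: "\<forall>\<^sub>F n in sequentially. label b n u = label b n v"
    by (rule eventually_sequentiallyI)
  have "limit_label b u k = limit_label b v k" for k
    unfolding limit_label_def by (rule eventually_cong[OF ev]) simp
  then show "e \<in> clust E (limit_label b)" using E uv by (auto simp: clust_def)
qed

text \<open>The graph \<open>E'\<close> may be larger than that of the limit labels because the
  final labels are real numbers, and two bit sequences can represent the same number. Such
  coincidences only enlarge clusters.\<close>

lemma infinite_component_if_good:
  assumes x: "x \<in> V" and E': "clust E (limit_label b) \<subseteq> E'"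
    and good: "\<forall>\<^sub>F m in sequentially. settled b m x \<and> (5 / 4) ^ m \<le> real (card (cluster b m x))"
  shows "infinite (graph_component E' x)"
proof
  assume fin: "finite (graph_component E' x)"
  obtain N where N: "\<And>m. N \<le> m \<Longrightarrow> (5 / 4) ^ m \<le> real (card (cluster b m x))"
    using good by (auto simp: eventually_sequentially)
  obtain M where M: "real (card (graph_component E' x)) < (5 / 4) ^ M"
    using real_arch_pow[of "5 / 4"] by auto
  define m where "m = max N M"
  have "cluster b m x \<subseteq> graph_component E' x"
  proof
    fix y assume y: "y \<in> cluster b m x"
    have "(clust E (root b m))\<^sup>* \<subseteq> E'\<^sup>*"
      by (rule rtrancl_mono[OF order_trans[OF clust_root_subset E']])
    moreover have "(x, y) \<in> (E \<inter> cluster b m x \<times> cluster b m x)\<^sup>*"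
      using connected_in_cluster mem_cluster_self[OF x] y unfolding connected_in_def by blast
    moreover have "E \<inter> cluster b m x \<times> cluster b m x \<subseteq> clust E (root b m)"
      by (auto simp: clust_def cluster_def)
    ultimately show "y \<in> graph_component E' x"
      unfolding graph_component_def using rtrancl_mono by blast
  qed
  then have "real (card (cluster b m x)) \<le> real (card (graph_component E' x))"
    using card_mono[OF fin] by simp
  moreover have "(5 / 4 :: real) ^ M \<le> (5 / 4) ^ m" by (rule power_increasing) (simp_all add: m_def)
  moreover have "(5 / 4) ^ m \<le> real (card (cluster b m x))" by (rule N) (simp add: m_def)
  ultimately show False using M by linarith
qed

lemma limit_label_translate:
  assumes "g \<in> V" "x \<in> V"
  shows "limit_label (translate g b) x = limit_label b (inv g \<otimes> x)"
proof -
  have x: "g \<otimes> (inv g \<otimes> x) = x" using assms by (simp flip: m_assoc)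
  have "label (translate g b) m x = label b m (inv g \<otimes> x)" for m
    using state_translate(2)[OF assms(1), of "inv g \<otimes> x" b m] assms by (simp add: x)
  then show ?thesis by (simp add: limit_label_def fun_eq_iff)
qed

lemma digit_field_shift:
  assumes "g \<in> V"
  shows "digit_field V (shift G g \<omega>) = translate g (digit_field V \<omega>)"
  using assms by (auto simp: digit_field_def shift_def translate_def fun_eq_iff)

end

theorem mainTheorem2:
  fixes G :: "('a, 'm) monoid_scheme" and S :: "'a set"
  assumes "group G" and "countable (carrier G)" and "S \<subseteq> carrier G"
    and "regular_tree 3 (carrier G) (cayley_edges G S)"
  shows "\<exists>\<Theta> :: ('a \<Rightarrow> real) \<Rightarrow> 'a \<Rightarrow> real.
    fiid_labeling G unit_interval \<Theta> \<and>
    (\<forall>\<gamma>\<in>carrier G. marginal G unit_interval \<Theta> \<gamma> = unit_interval) \<and>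
    (AE \<omega> in iid_uniform G.
       \<forall>C\<in>clusters (carrier G) (cayley_edges G S) (\<Theta> \<omega>). infinite C)"
proof -
  interpret tree_group G S using assms by (intro tree_group.intro tree_group_axioms.intro)
  let ?b = "digit_field V :: ('a \<Rightarrow> real) \<Rightarrow> 'a \<times> nat \<times> nat \<Rightarrow> bool"
  define \<Theta> where "\<Theta> \<omega> = (\<lambda>\<gamma>\<in>V. binary_value (limit_label (?b \<omega>) \<gamma>))" for \<omega>
  have b: "?b \<in> iid_uniform G \<rightarrow>\<^sub>M coin_field" and distr_b: "distr (iid_uniform G) coin_field ?b = coin_field"
    unfolding iid_uniform_def by (rule measurable_digit_field, rule distr_digit_field)
  have lim: "(\<lambda>\<omega>. limit_label (?b \<omega>) x) \<in> iid_uniform G \<rightarrow>\<^sub>M bits UNIV" if "x \<in> V" for x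
    by (rule measurable_compose[OF b measurable_limit_label[OF that]])
  have "\<Theta> \<in> iid_uniform G \<rightarrow>\<^sub>M (\<Pi>\<^sub>M \<gamma>\<in>V. unit_interval)"
    unfolding \<Theta>_def[abs_def]
    by (rule measurable_restrict) (rule measurable_compose[OF lim measurable_binary_value])
  moreover have "\<Theta> (shift G \<gamma> \<omega>) = shift G \<gamma> (\<Theta> \<omega>)" if "\<gamma> \<in> V" for \<gamma> \<omega>
    unfolding \<Theta>_def digit_field_shift[OF that]
    using that by (auto simp: shift_def limit_label_translate fun_eq_iff)
  ultimately have "fiid_labeling G unit_interval \<Theta>" by (simp add: fiid_labeling_def)
  moreover have "marginal G unit_interval \<Theta> \<gamma> = unit_interval" if "\<gamma> \<in> V" for \<gamma>
  proof -
    have "marginal G unit_interval \<Theta> \<gamma>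
        = distr (iid_uniform G) unit_interval (binary_value \<circ> ((\<lambda>b. limit_label b \<gamma>) \<circ> ?b))"
      unfolding marginal_def by (rule distr_cong) (simp_all add: \<Theta>_def that)
    also have "\<dots> = distr (distr (distr (iid_uniform G) coin_field ?b) (bits UNIV) (\<lambda>b. limit_label b \<gamma>))
        unit_interval binary_value"
      unfolding distr_distr[OF measurable_limit_label[OF that] b]
      by (rule distr_distr[symmetric, OF measurable_binary_value])
        (rule measurable_comp[OF b measurable_limit_label[OF that]])
    also have "\<dots> = unit_interval"
      by (simp only: distr_b distr_limit_label[OF that] distr_binary_value)
    finally show ?thesis .
  qed
  moreover have "AE \<omega> in iid_uniform G. \<forall>C\<in>clusters V E (\<Theta> \<omega>). infinite C"
  proof -
    \<comment> \<open>Countability of the group gives one almost sure event for all vertices, which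
      is then pulled back from the coins to the uniform variables.\<close>
    have "AE b in coin_field. \<forall>x\<in>V. \<forall>\<^sub>F m in sequentially.
        settled b m x \<and> (5 / 4) ^ m \<le> real (card (cluster b m x))"
      using AE_eventually_good by (simp add: AE_ball_countable countable_carrier)
    then have "AE \<omega> in iid_uniform G. \<forall>x\<in>V. \<forall>\<^sub>F m in sequentially.
        settled (?b \<omega>) m x \<and> (5 / 4) ^ m \<le> real (card (cluster (?b \<omega>) m x))"
      by (intro AE_distrD[OF b]) (simp only: distr_b)
    then show ?thesis
    proof (rule AE_mp, intro AE_I2 impI)
      fix \<omega> assume good: "\<forall>x\<in>V. \<forall>\<^sub>F m in sequentially.
        settled (?b \<omega>) m x \<and> (5 / 4) ^ m \<le> real (card (cluster (?b \<omega>) m x))"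
      have "clust E (limit_label (?b \<omega>)) \<subseteq> clust E (\<Theta> \<omega>)"
        using E_subset by (auto simp: clust_def \<Theta>_def)
      then show "\<forall>C\<in>clusters V E (\<Theta> \<omega>). infinite C"
        using infinite_component_if_good good by (auto simp: clusters_def graph_components_def)
    qed
  qed
  ultimately show ?thesis by blast
qed

end
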